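(* For every integer $n \geq 3$, $\mathrm{ex}_{\mathcal{P}}(n,C_3,K_4) \leq \frac{7}{3}n-6$, and this bound is attained for every $n$ divisible by $3$.
   Context: For graphs $H$ and $F$, $\mathrm{ex}_{\mathcal{P}}(n,H,F)$ denotes the maximum number of copies of $H$ (subgraphs isomorphic to $H$) in an $n$-vertex simple planar graph that contains no subgraph isomorphic to $F$. $C_3$ is the triangle and $K_4$ the complete graph on $4$ vertices. *)

theory Defs
  imports "HOL-Analysis.Analysis"
begin

datatype 'a graph = Graph (verts: "'a set") (edges: "'a set set")

definition simple_graph :: "'a graph \<Rightarrow> bool" where
  "simple_graph G \<longleftrightarrow>
     finite (verts G) \<and> edges G \<subseteq> {e. e \<subseteq> verts G \<and> card e = 2}"

definition subgraph :: "'a graph \<Rightarrow> 'a graph \<Rightarrow> bool" where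
  "subgraph K G \<longleftrightarrow> simple_graph K \<and> verts K \<subseteq> verts G \<and> edges K \<subseteq> edges G"

definition graph_iso :: "'a graph \<Rightarrow> 'b graph \<Rightarrow> bool" where
  "graph_iso G H \<longleftrightarrow>
     (\<exists>f. bij_betw f (verts G) (verts H) \<and> edges H = (\<lambda>e. f ` e) ` edges G)"

(* Subgraphs need not be induced. *)
definition copies :: "'b graph \<Rightarrow> 'a graph \<Rightarrow> 'a graph set" where
  "copies H G = {K. subgraph K G \<and> graph_iso H K}"

(* A drawing places the vertices at distinct points p v of the plane and represents each
   edge e by an arc \<gamma> e joining its endpoints. Such an arc passes through no further
   vertex, and two arcs meet at most at common endpoints. *)
definition planar :: "'a graph \<Rightarrow> bool" where
  "planar G \<longleftrightarrow>
     (\<exists>(p :: 'a \<Rightarrow> complex) (\<gamma> :: 'a set \<Rightarrow> real \<Rightarrow> complex).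
        inj_on p (verts G) \<and>
        (\<forall>e\<in>edges G. arc (\<gamma> e) \<and>
           {pathstart (\<gamma> e), pathfinish (\<gamma> e)} = p ` e \<and>
           path_image (\<gamma> e) \<inter> p ` verts G = p ` e) \<and>
        (\<forall>e\<in>edges G. \<forall>e'\<in>edges G. e \<noteq> e' \<longrightarrow>
           path_image (\<gamma> e) \<inter> path_image (\<gamma> e') \<subseteq> p ` (e \<inter> e')))"

(* Up to isomorphism every finite graph has its vertices in nat, so graphs on nat suffice.
   There are infinitely many of them with n vertices, but the numbers of copies are bounded
   in terms of n, so Max is taken over a finite set. (Max is unspecified if that set is
   empty, i.e. if every planar graph on n vertices contains F.) *)
definition ex_planar :: "nat \<Rightarrow> 'a graph \<Rightarrow> 'b graph \<Rightarrow> nat" where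
  "ex_planar n H F =
     Max {card (copies H G) | G :: nat graph.
            simple_graph G \<and> card (verts G) = n \<and> planar G \<and> copies F G = {}}"

(* A cycle only for k >= 3: below that it has loops or a single edge. *)
definition cycle_graph :: "nat \<Rightarrow> nat graph" where
  "cycle_graph k = Graph {..<k} {{i, (i + 1) mod k} | i. i < k}"

definition complete_graph :: "nat \<Rightarrow> nat graph" where
  "complete_graph k = Graph {..<k} {e. e \<subseteq> {..<k} \<and> card e = 2}"

end

(* Upper bound, by induction on n. A triangle with vertices on both sides cuts the graph into two
   smaller ones that share exactly this triangle, and 7/3 n - 6 is additive under such a
   decomposition. Without such a triangle every edge lies in at most two triangles: of the three
   paths u, w_i, v through common neighbours of u and v, one would otherwise close up with the edge
   uv to a triangle that separates the other two. So 3 t <= 2 e, and e <= 3 n - 6 is good enough for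
   n >= 6, while K4-freeness bounds e for n <= 5.

   The bound e <= 3 n - 6 does not go through Euler's formula. In a minimal counterexample, each of
   the two sides of a cycle of length k, containing m vertices, contains at most 3 m + k - 3 edges:
   two cycle vertices are joined by a path inside that side, which cuts it into two smaller ones.
   All topology is thereby reduced to the theta curve theorem: three arcs with common endpoints
   divide the plane into three regions.

   Equality: concentric triangles, consecutive ones joined to an octahedron, drawn by
   lines and spirals in logarithmic polar coordinates. *)
theory Submission
  imports Defs "HOL-Complex_Analysis.Winding_Numbers"
begin

section \<open>Theta curves\<close>

text \<open>The slope 7/3 comes from the octahedron: stacking one more of them on a triangle adds 3
  vertices and 7 of its 8 triangles, and a single triangle, the case n = 3, fixes the constant -6.
  Two parts that share a triangle have n + 3 vertices in total, and that triangle is counted twice,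
  so the two bounds add up to 7/3 (n + 3) - 12 - 1 = 7/3 n - 6.

  The faces of the whole drawing are never considered. Only complements of closed curves and of
  theta curves occur, because a side of a cycle is always cut by a single path. This path needs two
  different ends on the cycle, and a part of the graph that is attached at only one vertex may not
  provide them. Minimality of the counterexample excludes such parts, since the bounds for the two
  pieces would add up to too little. For a cycle of length k with m1 and m2 vertices on its sides,
  the edges then number at most k + (3 m1 + k - 3) + (3 m2 + k - 3) = 3 (k + m1 + m2) - 6.\<close>

definition arc_between :: "complex set \<Rightarrow> complex \<Rightarrow> complex \<Rightarrow> bool" where
  "arc_between A a b \<longleftrightarrow>
     (\<exists>g. arc g \<and> pathstart g = a \<and> pathfinish g = b \<and> path_image g = A)"

lemma arc_between_sym: "arc_between A a b \<Longrightarrow> arc_between A b a"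
  unfolding arc_between_def
  by (metis arc_reversepath path_image_reversepath pathfinish_reversepath pathstart_reversepath)

text \<open>Connectedness will keep an open arc within one component of a complement, and its
  density in the arc carries the position over to the endpoints.\<close>

lemma arc_between_interior:
  assumes "arc_between A a b"
  shows "connected (A - {a, b})" and "A - {a, b} \<noteq> {}" and "A \<subseteq> closure (A - {a, b})"
proof -
  obtain g where g: "arc g" "pathstart g = a" "pathfinish g = b" "path_image g = A"
    using assms arc_between_def by auto
  then have s: "simple_path g" by (simp add: arc_imp_simple_path)
  show c: "connected (A - {a, b})" and "A - {a, b} \<noteq> {}"
    using connected_simple_path_endless [OF s] nonempty_simple_path_endless [OF s] g by auto
  have eq: "A - {a, b} = g ` {0<..<1}"
    using simple_path_endless [OF s] g by simp
  have "continuous_on (closure {0<..<1}) g"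
    using g(1) by (simp add: arc_def path_def)
  then have "g ` closure {0<..<1} \<subseteq> closure (g ` {0<..<1})"
    by (intro image_closure_subset) (auto simp: closure_subset)
  then show "A \<subseteq> closure (A - {a, b})"
    unfolding eq using g(4) by (simp add: path_image_def)
qed

lemma arc_between_Un:
  assumes "arc_between A a b" "arc_between B b c" "A \<inter> B \<subseteq> {b}"
  shows "arc_between (A \<union> B) a c"
proof -
  obtain g where g: "arc g" "pathstart g = a" "pathfinish g = b" "path_image g = A"
    using assms arc_between_def by auto
  obtain h where h: "arc h" "pathstart h = b" "pathfinish h = c" "path_image h = B"
    using assms arc_between_def by auto
  have "arc (g +++ h)" using g h assms by (intro arc_join) auto
  then show ?thesis unfolding arc_between_def using g h
    by (metis path_image_join pathfinish_join pathstart_join)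
qed

lemma jordan_arcs:
  assumes "arc_between A a b" "arc_between B a b" "A \<inter> B = {a, b}"
  shows "inside (A \<union> B) \<noteq> {}" "open (inside (A \<union> B))" "connected (inside (A \<union> B))"
    "outside (A \<union> B) \<noteq> {}" "open (outside (A \<union> B))" "connected (outside (A \<union> B))"
    "inside (A \<union> B) \<union> outside (A \<union> B) = - (A \<union> B)"
    "inside (A \<union> B) \<inter> outside (A \<union> B) = {}"
    "frontier (inside (A \<union> B)) = A \<union> B" "frontier (outside (A \<union> B)) = A \<union> B"
proof -
  obtain g where g: "arc g" "pathstart g = a" "pathfinish g = b" "path_image g = A"
    using assms arc_between_def by auto
  obtain h where h: "arc h" "pathstart h = a" "pathfinish h = b" "path_image h = B"
    using assms arc_between_def by auto
  let ?c = "g +++ reversepath h"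
  have s: "simple_path ?c"
    using g h assms by (intro simple_path_join_loop) (auto simp: arc_reversepath)
  have l: "pathfinish ?c = pathstart ?c" using g h by simp
  have i: "path_image ?c = A \<union> B" using g h by (simp add: path_image_join)
  show "inside (A \<union> B) \<noteq> {}" "open (inside (A \<union> B))" "connected (inside (A \<union> B))"
    "outside (A \<union> B) \<noteq> {}" "open (outside (A \<union> B))" "connected (outside (A \<union> B))"
    "inside (A \<union> B) \<union> outside (A \<union> B) = - (A \<union> B)"
    "inside (A \<union> B) \<inter> outside (A \<union> B) = {}"
    "frontier (inside (A \<union> B)) = A \<union> B" "frontier (outside (A \<union> B)) = A \<union> B"
    using Jordan_inside_outside [OF s l] unfolding i by simp_all
qed

text \<open>A connected set in the complement of \<open>J\<close> that contains \<open>W\<close>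
  cannot be split by the disjoint open sets \<open>W\<close> and \<open>X\<close>, so
  \<open>W\<close> is already maximal.\<close>

lemma components_eq_two:
  fixes J :: "'a::euclidean_space set"
  assumes "U \<union> V = - J" "U \<inter> V = {}" "open U" "open V" "connected U" "connected V" "U \<noteq> {}" "V \<noteq> {}"
  shows "components (- J) = {U, V}"
proof -
  have m: "W \<in> components (- J)"
    if w: "W \<union> X = - J" "W \<inter> X = {}" "open W" "open X" "connected W" "W \<noteq> {}" for W X
  proof -
    have "T = W" if "T \<noteq> {}" "W \<subseteq> T" "T \<subseteq> - J" "connected T" for T
      using connectedD [OF \<open>connected T\<close> w(3,4)] that w by auto
    then show ?thesis unfolding in_components_maximal using w by auto
  qed
  have "U \<in> components (- J)" "V \<in> components (- J)"
    using m [of U V] m [of V U] assms by auto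
  moreover have "C \<in> {U, V}" if "C \<in> components (- J)" for C
  proof -
    have "C \<inter> U \<noteq> {} \<or> C \<inter> V \<noteq> {}"
      using in_components_subset [OF that] in_components_nonempty [OF that] assms(1) by blast
    then show ?thesis using components_eq that calculation by blast
  qed
  ultimately show ?thesis by auto
qed

lemma jordan_components:
  assumes "arc_between A a b" "arc_between B a b" "A \<inter> B = {a, b}"
  shows "components (- (A \<union> B)) = {inside (A \<union> B), outside (A \<union> B)}"
  using jordan_arcs [OF assms] by (intro components_eq_two) auto

section \<open>The three regions of a theta curve\<close>

definition theta :: "complex \<Rightarrow> complex \<Rightarrow> complex set \<Rightarrow> complex set \<Rightarrow> complex set \<Rightarrow> bool" where
  "theta a b A B P \<longleftrightarrow> arc_between A a b \<and> arc_between B a b \<and> arc_between P a b \<and>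
     A \<inter> B = {a, b} \<and> A \<inter> P = {a, b} \<and> B \<inter> P = {a, b}"

lemma theta_perm:
  assumes "theta a b A B P"
  shows "theta a b B A P" "theta a b A P B" 
  using assms unfolding theta_def by auto

(* The side of the closed curve A Un B on which the third arc P of a theta curve does not lie. *)
definition far :: "complex set \<Rightarrow> complex set \<Rightarrow> complex set \<Rightarrow> complex set" where
  "far A B P = (if P \<inter> inside (A \<union> B) = {} then inside (A \<union> B) else outside (A \<union> B))"

lemma far_commute: "far A B P = far B A P"
  by (simp add: far_def Un_commute)

text \<open>The open arc of \<open>P\<close> is connected and misses \<open>A\<close> and
  \<open>B\<close>, hence lies on one side of their closed curve. So the test in \<open>far\<close>,
  which looks for a single point of \<open>P\<close> inside, decides the position of the whole open
  arc.\<close>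

lemma far_eq:
  assumes "theta a b A B P"
  shows "P - {a, b} \<subseteq> inside (A \<union> B) \<and> far A B P = outside (A \<union> B) \<or>
         P - {a, b} \<subseteq> outside (A \<union> B) \<and> far A B P = inside (A \<union> B)"
proof -
  have th: "arc_between A a b" "arc_between B a b" "arc_between P a b"
    "A \<inter> B = {a, b}" "A \<inter> P = {a, b}" "B \<inter> P = {a, b}" using assms theta_def by auto
  note J = jordan_arcs [OF th(1,2,4)]
  define I Q where "I = inside (A \<union> B)" and "Q = outside (A \<union> B)"
  have IQ: "open I" "open Q" "I \<inter> Q = {}" "I \<union> Q = - (A \<union> B)"
    using J unfolding I_def Q_def by auto
  have c: "connected (P - {a, b})" and ne: "P - {a, b} \<noteq> {}"
    using arc_between_interior [OF th(3)] by auto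
  have sub: "P - {a, b} \<subseteq> I \<union> Q"
    using th(5,6) unfolding IQ(4) by auto
  have "I \<inter> (P - {a, b}) = {} \<or> Q \<inter> (P - {a, b}) = {}"
    using connectedD [OF c IQ(1,2) _ sub] IQ(3) by blast
  then have "P - {a, b} \<subseteq> I \<or> P - {a, b} \<subseteq> Q" using sub by blast
  moreover have "a \<notin> I" "b \<notin> I" using IQ(4) th(4) by auto
  ultimately have "P - {a, b} \<subseteq> I \<and> P \<inter> I \<noteq> {} \<or> P - {a, b} \<subseteq> Q \<and> P \<inter> I = {}"
    using ne IQ(3) by (elim disjE) auto
  then show ?thesis
    unfolding far_def I_def [symmetric] Q_def [symmetric] by (elim disjE) simp_all
qed

lemma far_props:
  assumes "theta a b A B P"
  shows "far A B P \<in> components (- (A \<union> B))" "far A B P \<inter> P = {}" "far A B P \<inter> (A \<union> B) = {}"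
    "open (far A B P)" "connected (far A B P)" "far A B P \<noteq> {}" "frontier (far A B P) = A \<union> B"
proof -
  have th: "arc_between A a b" "arc_between B a b" "arc_between P a b"
    "A \<inter> B = {a, b}" "A \<inter> P = {a, b}" "B \<inter> P = {a, b}" using assms theta_def by auto
  note J = jordan_arcs [OF th(1,2,4)]
  show "far A B P \<in> components (- (A \<union> B))"
    unfolding jordan_components [OF th(1,2,4)] far_def by simp
  show "far A B P \<inter> P = {}" using far_eq [OF assms] J(7,8) th by blast
  show "far A B P \<inter> (A \<union> B) = {}" unfolding far_def using J(7) by auto
  show "open (far A B P)" "connected (far A B P)" "far A B P \<noteq> {}" "frontier (far A B P) = A \<union> B"
    using J unfolding far_def by auto
qed

(* If the two regions met, the first, being connected and disjoint from A Un P, would lie inside the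
   second; but its frontier contains B, which the second region stays away from. *)
lemma far_disjoint:
  assumes "theta a b A B P"
  shows "far A B P \<inter> far A P B = {}"
proof (rule ccontr)
  assume ne: "far A B P \<inter> far A P B \<noteq> {}"
  note X = far_props [OF assms] and Y = far_props [OF theta_perm(2) [OF assms]]
  have th: "arc_between B a b" "A \<inter> B = {a, b}" "B \<inter> P = {a, b}"
    using assms theta_def by auto
  have "far A B P \<subseteq> far A P B"
    using components_maximal [OF Y(1) X(5)] X(2,3) ne by blast
  then have cl: "closure (far A B P) \<subseteq> closure (far A P B)" by (rule closure_mono)
  have "B \<subseteq> closure (far A B P)"
    using X(7) unfolding frontier_def by blast
  then have "B \<subseteq> far A P B \<union> frontier (far A P B)"
    using cl closure_Un_frontier by (metis order_trans)
  then have "B \<subseteq> far A P B \<union> (A \<union> P)" unfolding Y(7) .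
  then have "B - {a, b} \<subseteq> far A P B" using th by blast
  then show False using Y(2) arc_between_interior(2) [OF th(1)] by blast
qed

text \<open>Running along \<open>A\<close> and back along \<open>B\<close> is a simple closed path,
  and its winding number is the difference. The sign at inner points depends on the orientation,
  which is unknown, so both units are allowed.\<close>

lemma inside_iff_winding:
  assumes g: "arc g" "pathstart g = a" "pathfinish g = b" "path_image g = A"
    and h: "arc h" "pathstart h = a" "pathfinish h = b" "path_image h = B"
    and AB: "A \<inter> B = {a, b}" and z: "z \<notin> A \<union> B"
  shows "winding_number g z - winding_number h z \<in> (if z \<in> inside (A \<union> B) then {1, -1} else {0})"
proof -
  let ?c = "g +++ reversepath h"
  have s: "simple_path ?c"
    using g h AB by (intro simple_path_join_loop) (auto simp: arc_reversepath)
  have l: "pathfinish ?c = pathstart ?c" using g h by simp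
  have i: "path_image ?c = A \<union> B" using g h by (simp add: path_image_join)
  have w: "winding_number ?c z = winding_number g z - winding_number h z"
    using g h z by (simp add: winding_number_join winding_number_reversepath arc_imp_path)
  show ?thesis
  proof (cases "z \<in> inside (A \<union> B)")
    case True
    have "winding_number ?c z = 1 \<or> winding_number ?c z = -1"
      using simple_closed_path_winding_number_inside [OF s] True unfolding i by metis
    then show ?thesis using True unfolding w by simp
  next
    case False
    then have "z \<in> outside (path_image ?c)" using z False by (simp add: i outside_inside)
    then have "winding_number ?c z = 0"
      by (intro winding_number_zero_in_outside simple_path_imp_path s l)
    then show ?thesis using w False by simp
  qed
qed

(* The three differences of the winding numbers of A, B and P add up to 0, and each is 0 or a
   unit according to the side of the respective closed curve. *)
lemma theta_parity:
  assumes "theta a b A B P" "z \<notin> A \<union> B \<union> P"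
  shows "z \<in> inside (A \<union> B) \<longleftrightarrow> (z \<in> inside (A \<union> P) \<longleftrightarrow> z \<notin> inside (B \<union> P))"
proof -
  obtain f where f: "arc f" "pathstart f = a" "pathfinish f = b" "path_image f = A"
    using assms unfolding theta_def arc_between_def by auto
  obtain g where g: "arc g" "pathstart g = a" "pathfinish g = b" "path_image g = B"
    using assms unfolding theta_def arc_between_def by auto
  obtain h where h: "arc h" "pathstart h = a" "pathfinish h = b" "path_image h = P"
    using assms unfolding theta_def arc_between_def by auto
  have th: "A \<inter> B = {a, b}" "A \<inter> P = {a, b}" "B \<inter> P = {a, b}"
    using assms theta_def by auto
  define x y where "x = winding_number f z - winding_number g z"
    and "y = winding_number g z - winding_number h z"
  have "x \<in> (if z \<in> inside (A \<union> B) then {1, -1} else {0})"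
       "y \<in> (if z \<in> inside (B \<union> P) then {1, -1} else {0})"
       "x + y \<in> (if z \<in> inside (A \<union> P) then {1, -1} else {0})"
    using inside_iff_winding [OF f g th(1)] inside_iff_winding [OF g h th(3)]
      inside_iff_winding [OF f h th(2)] assms(2) unfolding x_def y_def by auto
  \<comment> \<open>Two units never add up to a unit, so either none or exactly two of the three
    differences are nonzero.\<close>
  then show ?thesis by (auto split: if_splits)
qed

(* By theta_parity, the number of regions containing a point z has the same parity for all z off
   the theta curve, and it is 1 on far A B P. *)
lemma far_cover:
  assumes T: "theta a b A B P" and z: "z \<notin> A \<union> B \<union> P"
  shows "z \<in> far A B P \<or> z \<in> far A P B \<or> z \<in> far B P A"
proof -
  have T2: "theta a b A P B" and T3: "theta a b B P A"
    using T theta_perm by blast+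
  have th: "arc_between A a b" "arc_between B a b" "arc_between P a b"
    "A \<inter> B = {a, b}" "A \<inter> P = {a, b}" "B \<inter> P = {a, b}" using T theta_def by auto
  have m: "w \<in> far A B P \<longleftrightarrow> (w \<in> inside (A \<union> B) \<longleftrightarrow> P \<inter> inside (A \<union> B) = {})"
          "w \<in> far A P B \<longleftrightarrow> (w \<in> inside (A \<union> P) \<longleftrightarrow> B \<inter> inside (A \<union> P) = {})"
          "w \<in> far B P A \<longleftrightarrow> (w \<in> inside (B \<union> P) \<longleftrightarrow> A \<inter> inside (B \<union> P) = {})"
    if "w \<notin> A \<union> B \<union> P" for w
    using that unfolding far_def by (auto simp: outside_inside)
  obtain w where w: "w \<in> far A B P" using far_props(6) [OF T] by auto
  then have w': "w \<notin> A \<union> B \<union> P" using far_props(2,3) [OF T] by blast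
  have "w \<notin> far A P B" using far_disjoint [OF T] w by blast
  moreover have "w \<notin> far B P A"
    using far_disjoint [OF theta_perm(1) [OF T]] w by (auto simp: far_commute)
  ultimately show ?thesis
    using theta_parity [OF T w'] theta_parity [OF T z] m [OF w'] m [OF z] w by blast
qed

text \<open>The theta curve theorem: \<open>far_disjoint\<close> for all permutations of the arcs,
  together with \<open>far_cover\<close>.\<close>

lemma theta_trichotomy:
  assumes T: "theta a b A B P" and z: "z \<notin> A \<union> B \<union> P"
  shows "z \<in> far A B P \<and> z \<notin> far A P B \<and> z \<notin> far B P A \<or>
         z \<notin> far A B P \<and> z \<in> far A P B \<and> z \<notin> far B P A \<or>
         z \<notin> far A B P \<and> z \<notin> far A P B \<and> z \<in> far B P A"
proof -
  have "far A B P \<inter> far A P B = {}" using T by (rule far_disjoint)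
  moreover have "far A B P \<inter> far B P A = {}" 
    using far_disjoint [OF theta_perm(1) [OF T]] by (simp add: far_commute)
  moreover have "far A P B \<inter> far B P A = {}"
    using far_disjoint [OF theta_perm(1) [OF theta_perm(2) [OF T]]]
    by (simp add: far_commute)
  ultimately show ?thesis using far_cover [OF T z] by blast
qed

text \<open>The form of the theta curve theorem that drives the induction: \<open>S\<close> is the
  side of \<open>A\<close> and \<open>B\<close> other than \<open>far A B P\<close>, and
  \<open>P\<close> cuts it into the two remaining regions.\<close>

lemma theta_split:
  assumes T: "theta a b A B P" and S: "S \<in> components (- (A \<union> B))" and P: "P - {a, b} \<subseteq> S"
  obtains S1 S2 where "S1 \<in> components (- (A \<union> P))" "S2 \<in> components (- (B \<union> P))"
    "S1 \<inter> S2 = {}" "S = S1 \<union> S2 \<union> (P - {a, b})" "S1 \<inter> P = {}" "S2 \<inter> P = {}"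
proof
  have T2: "theta a b A P B" and T3: "theta a b B P A"
    using T theta_perm by blast+
  have th: "arc_between A a b" "arc_between B a b" "arc_between P a b"
    "A \<inter> B = {a, b}" "A \<inter> P = {a, b}" "B \<inter> P = {a, b}" using T theta_def by auto
  note J = jordan_arcs [OF th(1,2,4)]
  have "far A B P \<noteq> S"
    using far_props(2) [OF T] P arc_between_interior(2) [OF th(3)] by auto
  then have "{far A B P, S} = {inside (A \<union> B), outside (A \<union> B)}"
    using S far_props(1) [OF T] unfolding jordan_components [OF th(1,2,4)] by auto
  then have S': "far A B P \<inter> S = {}" "far A B P \<union> S = - (A \<union> B)"
    using J(7,8) unfolding doubleton_eq_iff by (metis Int_commute, metis Un_commute)
  show "far A P B \<in> components (- (A \<union> P))" "far B P A \<in> components (- (B \<union> P))"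
    "far A P B \<inter> P = {}" "far B P A \<inter> P = {}"
    using far_props [OF T2] far_props [OF T3] by auto
  show "far A P B \<inter> far B P A = {}"
    using far_disjoint [OF theta_perm(1) [OF T2]] by (simp add: far_commute)
  have "x \<in> S \<longleftrightarrow> x \<in> far A P B \<union> far B P A" if "x \<notin> P" for x
  proof (cases "x \<in> A \<union> B")
    case True
    then have "x \<notin> far A P B \<union> far B P A"
      using far_props(2,3) [OF T2] far_props(2,3) [OF T3] by blast
    then show ?thesis using True S'(2) by blast
  next
    case False
    then show ?thesis using theta_trichotomy [OF T, of x] that S' by blast
  qed
  moreover have "x \<in> S \<longleftrightarrow> x \<notin> {a, b}" if "x \<in> P" for x
    using that P S'(2) th by blast
  ultimately show "S = far A P B \<union> far B P A \<union> (P - {a, b})"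
    using far_props(2,3) [OF T2] far_props(2,3) [OF T3] by blast
qed

text \<open>That \<open>z\<close> lies in \<open>far E A B\<close> means that the closed curve of
  \<open>E\<close> and \<open>A\<close> separates \<open>C\<close> from \<open>B\<close>, and this
  is symmetric in \<open>B\<close> and \<open>C\<close>.\<close>

lemma far_swap:
  assumes T: "theta a b E A B" and T': "theta a b E A C"
    and y: "y \<in> B - {a, b}" and z: "z \<in> C - {a, b}" and BC: "z \<in> far E A B"
  shows "y \<in> far E A C"
proof -
  have th: "arc_between E a b" "arc_between A a b" "E \<inter> A = {a, b}" "E \<inter> B = {a, b}" "A \<inter> B = {a, b}"
    using T theta_def by auto
  have "y \<notin> far E A B" "z \<notin> far E A C"
    using y z far_props(2) [OF T] far_props(2) [OF T'] by auto
  moreover have "y \<notin> E \<union> A" using y th by auto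
  ultimately show ?thesis
    using BC unfolding far_def by (auto simp: outside_inside split: if_splits)
qed

text \<open>One of the curves that \<open>E\<close> forms with \<open>A\<close>, \<open>B\<close>
  and \<open>C\<close> separates the other two arcs. Otherwise, by the theta curve theorem for
  \<open>E\<close>, \<open>A\<close>, \<open>B\<close>, the curve of \<open>A\<close> and
  \<open>B\<close> separates \<open>C\<close> from \<open>E\<close>; likewise that of
  \<open>A\<close> and \<open>C\<close> separates \<open>B\<close> from \<open>E\<close>. Then
  \<open>E\<close> meets two disjoint regions of the theta curve \<open>A\<close>, \<open>B\<close>,
  \<open>C\<close>.\<close>

lemma four_arcs_separation:
  assumes T: "theta a b E A B" "theta a b E A C" "theta a b E B C" "theta a b A B C"
    and x: "x \<in> A - {a, b}" "y \<in> B - {a, b}" "z \<in> C - {a, b}" 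
  shows "y \<in> far E A C \<or> x \<in> far E B C \<or> x \<in> far E C B"
proof (rule ccontr)
  assume neg: "\<not> ?thesis"
  have "arc_between E a b" using T(1) theta_def by simp
  then obtain e where e: "e \<in> E - {a, b}"
    using arc_between_interior(2) by (metis ex_in_conv)
  have th: "E \<inter> A = {a, b}" "E \<inter> B = {a, b}" "E \<inter> C = {a, b}"
           "A \<inter> B = {a, b}" "A \<inter> C = {a, b}" "B \<inter> C = {a, b}"
    using T unfolding theta_def by auto
  have "z \<notin> E" "z \<notin> A" "z \<notin> B" using x(3) th(3) th(5) th(6) by auto
  moreover have "y \<notin> E" "y \<notin> A" "y \<notin> C" using x(2) th(2) th(4) th(6) by auto
  ultimately have n: "z \<notin> E \<union> A \<union> B" "y \<notin> E \<union> A \<union> C" by simp_all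
  note S1 = theta_perm(1) and S2 = theta_perm(2)
  have "z \<notin> far E A B"
    using far_swap [OF T(1,2) x(2,3)] neg by blast
  moreover have "z \<notin> far E B A"
    using far_swap [OF S2 [OF T(1)] T(3) x(1,3)] neg by blast
  ultimately have "z \<in> far A B E"
    using theta_trichotomy [OF T(1) n(1)] by simp
  then have e1: "e \<in> far A B C"
    by (rule far_swap [OF S2 [OF S1 [OF T(1)]] T(4) e x(3)])
  have "y \<notin> far E C A"
    using far_swap [OF S2 [OF T(2)] S2 [OF T(3)] x(1,2)] neg by blast
  then have "y \<in> far A C E"
    using theta_trichotomy [OF T(2) n(2)] neg by simp
  then have e2: "e \<in> far A C B"
    by (rule far_swap [OF S2 [OF S1 [OF T(2)]] S2 [OF T(4)] e x(2)])
  show False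
    using far_disjoint [OF T(4)] e1 e2 by blast
qed

section \<open>Paths and cycles in plane graphs\<close>

fun pedges :: "'a list \<Rightarrow> 'a set set" where
  "pedges (x # y # zs) = insert {x, y} (pedges (y # zs))"
| "pedges _ = {}"

text \<open>On a one-element list this is the degenerate set \<open>{{v}}\<close>. Where a genuine
  cycle is meant, the list has length at least 3.\<close>

definition cedges :: "'a list \<Rightarrow> 'a set set" where
  "cedges vs = pedges (vs @ [hd vs])"

lemma pedges_append: "pedges (xs @ y # zs) = pedges (xs @ [y]) \<union> pedges (y # zs)"
proof (induction xs)
  case (Cons x xs)
  then show ?case by (cases xs) auto
qed simp

lemma pedges_rev: "pedges (rev xs) = pedges xs"
proof (induction xs rule: pedges.induct)
  case (1 x y zs)
  have "pedges (rev (x # y # zs)) = pedges (rev zs @ [y]) \<union> pedges [y, x]"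
    using pedges_append [of "rev zs" y "[x]"] by simp
  then show ?case using 1 by (auto simp: insert_commute)
qed auto

lemma Union_pedges_subset: "\<Union> (pedges xs) \<subseteq> set xs"
  by (induction xs rule: pedges.induct) auto

lemma Union_pedges: "2 \<le> length xs \<Longrightarrow> \<Union> (pedges xs) = set xs"
proof (induction xs rule: pedges.induct)
  case (1 x y zs)
  then show ?case by (cases zs) auto
qed auto

lemma finite_pedges: "finite (pedges xs)"
  by (induction xs rule: pedges.induct) auto

lemma card_pedges_le: "card (pedges (x # xs)) \<le> length xs"
proof (induction xs arbitrary: x)
  case (Cons y ys)
  have "card (pedges (x # y # ys)) \<le> Suc (card (pedges (y # ys)))"
    by (simp add: card_insert_if finite_pedges)
  then show ?case using Cons [of y] by simp
qed simp

lemma pedges_subset_append: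
  "pedges xs \<subseteq> pedges (xs @ ys)" "pedges ys \<subseteq> pedges (xs @ ys)"
proof -
  show "pedges xs \<subseteq> pedges (xs @ ys)"
    by (induction xs rule: pedges.induct) (auto split: list.splits)
  show "pedges ys \<subseteq> pedges (xs @ ys)"
    using pedges_append [of xs "hd ys" "tl ys"] by (cases ys) simp_all
qed

lemma cedges_append:
  assumes "us \<noteq> []" "ws \<noteq> []"
  shows "cedges (us @ ws) = pedges (us @ [hd ws]) \<union> pedges (ws @ [hd us])"
  using assms pedges_append [of us "hd ws" "tl ws @ [hd us]"] unfolding cedges_def
  by (cases ws) auto

lemma cedges_rotate: "cedges (us @ ws) = cedges (ws @ us)"
proof (cases "us = [] \<or> ws = []")
  case False
  then show ?thesis by (simp add: cedges_append Un_commute)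
qed auto

lemma card_cedges_le: "card (cedges vs) \<le> length vs"
  using card_pedges_le [of "hd vs" "tl vs @ [hd vs]"] by (cases vs) (auto simp: cedges_def)

lemma Union_cedges:
  assumes "vs \<noteq> []"
  shows "\<Union> (cedges vs) = set vs"
proof -
  have "2 \<le> length (vs @ [hd vs])" using assms by (cases vs) auto
  then have "\<Union> (cedges vs) = set (vs @ [hd vs])" unfolding cedges_def by (rule Union_pedges)
  then show ?thesis using assms by (cases vs) auto
qed

text \<open>The list is rotated to start at \<open>c\<close> and then cut before \<open>d\<close>;
  neither operation changes the edges of the cycle.\<close>

lemma cycle_split:
  assumes "distinct vs" "c \<in> set vs" "d \<in> set vs" "c \<noteq> d"
  obtains us ws where "us \<noteq> []" "ws \<noteq> []" "hd us = c" "hd ws = d" "distinct (us @ ws)"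
    "set (us @ ws) = set vs" "cedges (us @ ws) = cedges vs" "length (us @ ws) = length vs"
proof -
  obtain a1 a2 where a: "vs = a1 @ c # a2" using assms(2) by (meson split_list)
  have "d \<in> set (a2 @ a1)" using assms a by auto
  then obtain b1 b2 where b: "a2 @ a1 = b1 @ d # b2" by (meson split_list)
  have eq: "(c # b1) @ (d # b2) = (c # a2) @ a1" using b by simp
  have "cedges ((c # a2) @ a1) = cedges vs" using cedges_rotate [of "c # a2" a1] a by simp
  moreover have "set ((c # a2) @ a1) = set vs" "length ((c # a2) @ a1) = length vs"
    "distinct ((c # a2) @ a1)" using a assms(1) by auto
  ultimately show ?thesis using that [of "c # b1" "d # b2"] unfolding eq [symmetric] by simp
qed

text \<open>A path is extended step by step and cut back whenever it returns to an earlier vertex.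
  Confinement to the reachable set is recorded because it will keep the path off a given
  cycle.\<close>

lemma rtrancl_distinct_path:
  assumes "(a, b) \<in> R\<^sup>*"
  obtains xs where "xs \<noteq> []" "distinct xs" "hd xs = a" "last xs = b"
    "set xs \<subseteq> R\<^sup>* `` {a}" "pedges xs \<subseteq> {{u, v} | u v. (u, v) \<in> R}"
proof -
  have "\<exists>xs. xs \<noteq> [] \<and> distinct xs \<and> hd xs = a \<and> last xs = b \<and>
     set xs \<subseteq> R\<^sup>* `` {a} \<and> pedges xs \<subseteq> {{u, v} | u v. (u, v) \<in> R}"
    using assms
  proof (induction rule: rtrancl_induct)
    case base
    then show ?case by (intro exI [of _ "[a]"]) auto
  next
    case (step b c)
    then obtain xs where xs: "xs \<noteq> []" "distinct xs" "hd xs = a" "last xs = b"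
      "set xs \<subseteq> R\<^sup>* `` {a}" "pedges xs \<subseteq> {{u, v} | u v. (u, v) \<in> R}" by blast
    show ?case
    proof (cases "c \<in> set xs")
      case True
      then obtain us ws where s: "xs = us @ c # ws" by (meson split_list)
      have "pedges (us @ [c]) \<subseteq> pedges xs"
        using pedges_subset_append(1) [of "us @ [c]" ws] s by simp
      moreover have "hd (us @ [c]) = a" using xs(3) s by (cases us) auto
      ultimately show ?thesis using xs s by (intro exI [of _ "us @ [c]"]) auto
    next
      case False
      have "xs = butlast xs @ [b]" using xs(1,4) by (metis append_butlast_last_id)
      then have "pedges (xs @ [c]) = pedges xs \<union> {{b, c}}"
        using pedges_append [of "butlast xs" b "[c]"]
        by (metis append.assoc append_Cons append_Nil pedges.simps(1,3))
      moreover have "c \<in> R\<^sup>* `` {a}" using step by auto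
      ultimately show ?thesis using xs False step(2) by (intro exI [of _ "xs @ [c]"]) auto
    qed
  qed
  then show ?thesis using that by blast
qed

text \<open>A drawing whose arcs are mere point sets: orientation and parametrization are forgotten,
  so \<open>I\<close> depends on the unordered edge alone. Subgraphs keep \<open>p\<close> and
  \<open>I\<close>, and inductions vary only \<open>V\<close> and \<open>E\<close>.\<close>

locale plane_graph =
  fixes V :: "'a set" and E :: "'a set set" and p :: "'a \<Rightarrow> complex" and I :: "'a set \<Rightarrow> complex set"
  assumes finite_V: "finite V"
    and E_sub: "E \<subseteq> {e. e \<subseteq> V \<and> card e = 2}"
    and inj_p: "inj_on p V"
    and edge_arc: "{u, v} \<in> E \<Longrightarrow> arc_between (I {u, v}) (p u) (p v)"
    and edge_V: "e \<in> E \<Longrightarrow> I e \<inter> p ` V = p ` e"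
    and edge_edge: "e \<in> E \<Longrightarrow> e' \<in> E \<Longrightarrow> e \<noteq> e' \<Longrightarrow> I e \<inter> I e' \<subseteq> p ` (e \<inter> e')"
begin

definition img :: "'a set set \<Rightarrow> complex set" where
  "img F = \<Union> (I ` F)"

lemma edgeE:
  assumes "e \<in> E"
  obtains u v where "e = {u, v}" "u \<noteq> v" "u \<in> V" "v \<in> V"
proof -
  have "card e = 2" "e \<subseteq> V" using assms E_sub by auto
  then show ?thesis using that by (auto simp: card_2_iff)
qed

lemma edge_in: "{u, v} \<in> E \<Longrightarrow> u \<in> V \<and> v \<in> V \<and> u \<noteq> v"
  using E_sub by (auto simp: card_insert_if split: if_splits)

lemma finite_E: "finite E"
  using E_sub finite_V by (auto intro: finite_subset [of E "Pow V"])

lemma edge_sub: "e \<in> E \<Longrightarrow> e \<subseteq> V"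
  using E_sub by auto

lemma img_Un: "img (F \<union> F') = img F \<union> img F'"
  by (auto simp: img_def)

text \<open>Reduces the intersection of two drawn edge sets to a computation with vertices.
  Disjointness is essential, as a common edge would contribute its whole arc.\<close>

lemma img_Int:
  assumes "F \<subseteq> E" "F' \<subseteq> E" "F \<inter> F' = {}"
  shows "img F \<inter> img F' = p ` (\<Union> F \<inter> \<Union> F')"
proof
  show "img F \<inter> img F' \<subseteq> p ` (\<Union> F \<inter> \<Union> F')"
  proof
    fix x assume "x \<in> img F \<inter> img F'"
    then obtain e e' where e: "e \<in> F" "e' \<in> F'" "x \<in> I e" "x \<in> I e'" unfolding img_def by auto
    then have "x \<in> p ` (e \<inter> e')" using edge_edge [of e e'] assms by blast
    then show "x \<in> p ` (\<Union> F \<inter> \<Union> F')" using e by auto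
  qed
  have "p v \<in> img H" if "v \<in> \<Union> H" "H \<subseteq> E" for v H
    using that edge_V edge_sub unfolding img_def by fastforce
  then show "p ` (\<Union> F \<inter> \<Union> F') \<subseteq> img F \<inter> img F'" using assms by auto
qed

lemma vertex_in_img:
  assumes "F \<subseteq> E" "v \<in> V"
  shows "p v \<in> img F \<longleftrightarrow> v \<in> \<Union> F"
proof
  assume "p v \<in> img F"
  then obtain e where e: "e \<in> F" "p v \<in> I e" by (auto simp: img_def)
  then have "p v \<in> p ` e" using edge_V [of e] assms by auto
  then obtain w where w: "w \<in> e" "p v = p w" by auto
  then have "w = v" using inj_p assms e edge_sub by (metis inj_onD subsetD)
  then show "v \<in> \<Union> F" using w e by auto
next
  assume "v \<in> \<Union> F"
  then obtain e where e: "e \<in> F" "v \<in> e" by auto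
  then have "p v \<in> I e" using edge_V [of e] assms(1) by auto
  then show "p v \<in> img F" using e by (auto simp: img_def)
qed

lemma path_arc:
  assumes "distinct xs" "2 \<le> length xs" "pedges xs \<subseteq> E"
  shows "arc_between (img (pedges xs)) (p (hd xs)) (p (last xs))"
  using assms
proof (induction xs rule: pedges.induct)
  case (1 x y zs)
  show ?case
  proof (cases zs)
    case Nil
    then show ?thesis using 1 edge_arc [of x y] by (simp add: img_def)
  next
    case (Cons z zs')
    have a: "arc_between (img (pedges (y # zs))) (p y) (p (last (x # y # zs)))"
      using 1 Cons by simp
    have b: "arc_between (img {{x, y}}) (p x) (p y)" using 1 edge_arc [of x y] by (simp add: img_def)
    have u: "\<Union> (pedges (y # zs)) \<subseteq> set (y # zs)" by (rule Union_pedges_subset)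
    then have "{x, y} \<notin> pedges (y # zs)" using 1(2) by auto
    then have "img {{x, y}} \<inter> img (pedges (y # zs)) = p ` ({x, y} \<inter> \<Union> (pedges (y # zs)))"
      using img_Int [of "{{x, y}}" "pedges (y # zs)"] 1 by auto
    also have "\<dots> \<subseteq> {p y}" using u 1(2) by auto
    finally have "arc_between (img {{x, y}} \<union> img (pedges (y # zs))) (p x) (p (last (x # y # zs)))"
      by (rule arc_between_Un [OF b a])
    then show ?thesis by (simp add: img_Un [symmetric])
  qed
qed auto

definition open_edge :: "'a set \<Rightarrow> complex set" where
  "open_edge e = I e - p ` e"

lemma open_edge_props:
  assumes "e \<in> E"
  shows "connected (open_edge e)" "open_edge e \<noteq> {}" "I e \<subseteq> closure (open_edge e)"
proof -
  obtain u v where e: "e = {u, v}" using edgeE assms by metis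
  then show "connected (open_edge e)" "open_edge e \<noteq> {}" "I e \<subseteq> closure (open_edge e)"
    using arc_between_interior [OF edge_arc [of u v]] assms unfolding open_edge_def by auto
qed

lemma open_edge_disjoint_img:
  assumes "F \<subseteq> E" "e \<in> E" "e \<notin> F"
  shows "open_edge e \<inter> img F = {}"
  using img_Int [of F "{e}"] assms unfolding open_edge_def by (auto simp: img_def)

lemma open_edge_subset_component:
  assumes "F \<subseteq> E" "e \<in> E" "e \<notin> F" "S \<in> components (- img F)" "open_edge e \<inter> S \<noteq> {}"
  shows "open_edge e \<subseteq> S"
  using components_maximal [OF assms(4) open_edge_props(1) [OF assms(2)]] open_edge_disjoint_img [OF assms(1-3)]
    assms(5) by blast

text \<open>The open edge together with its end \<open>v\<close> is still connected, as it lies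
  between the open edge and its closure. It misses the drawing of \<open>F\<close> because
  \<open>v\<close> is not on \<open>F\<close>, so one component contains all of it or none of
  it.\<close>

lemma open_edge_subset_iff_vertex:
  assumes F: "F \<subseteq> E" "e \<in> E" "v \<in> e" "v \<notin> \<Union> F" and S: "S \<in> components (- img F)"
  shows "open_edge e \<subseteq> S \<longleftrightarrow> p v \<in> S"
proof -
  have nF: "e \<notin> F" using F by auto
  have vV: "v \<in> V" using F edge_sub by auto
  have pI: "p v \<in> I e" using edge_V [OF F(2)] F(3) by auto
  let ?X = "insert (p v) (open_edge e)"
  have "connected ?X"
    using connected_intermediate_closure [OF open_edge_props(1) [OF F(2)], of ?X] open_edge_props(3) [OF F(2)] pI
    closure_subset by (metis insert_subset subset_insertI subsetD)
  moreover have "?X \<subseteq> - img F"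
    using open_edge_disjoint_img [OF F(1,2) nF] vertex_in_img [OF F(1) vV] F(4) by auto
  ultimately have "S \<inter> ?X \<noteq> {} \<Longrightarrow> ?X \<subseteq> S"
    using components_maximal [OF S] by blast
  then show ?thesis using open_edge_props(2) [OF F(2)] by auto
qed

lemma cycle_img_split:
  assumes "us \<noteq> []" "ws \<noteq> []" "distinct (us @ ws)" "cedges (us @ ws) \<subseteq> E" "3 \<le> length (us @ ws)"
  shows "img (cedges (us @ ws)) = img (pedges (us @ [hd ws])) \<union> img (pedges (ws @ [hd us]))"
    "arc_between (img (pedges (us @ [hd ws]))) (p (hd us)) (p (hd ws))"
    "arc_between (img (pedges (ws @ [hd us]))) (p (hd us)) (p (hd ws))"
    "img (pedges (us @ [hd ws])) \<inter> img (pedges (ws @ [hd us])) = {p (hd us), p (hd ws)}"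
proof -
  obtain c us' where us: "us = c # us'" using assms by (cases us) auto
  obtain d ws' where ws: "ws = d # ws'" using assms by (cases ws) auto
  have sub: "pedges (us @ [d]) \<subseteq> E" "pedges (ws @ [c]) \<subseteq> E"
    using assms(4) cedges_append [OF assms(1,2)] us ws by auto
  show "img (cedges (us @ ws)) = img (pedges (us @ [hd ws])) \<union> img (pedges (ws @ [hd us]))"
    using cedges_append [OF assms(1,2)] by (simp add: img_Un)
  show "arc_between (img (pedges (us @ [hd ws]))) (p (hd us)) (p (hd ws))"
    using path_arc [of "us @ [d]"] sub assms(3) us ws by auto
  show "arc_between (img (pedges (ws @ [hd us]))) (p (hd us)) (p (hd ws))"
    using path_arc [of "ws @ [c]"] sub assms(3) us ws by (auto intro: arc_between_sym)
  have u: "\<Union> (pedges (us @ [d])) = insert d (set us)" "\<Union> (pedges (ws @ [c])) = insert c (set ws)"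
    using Union_pedges [of "us @ [d]"] Union_pedges [of "ws @ [c]"] us ws by auto
  \<comment> \<open>A common edge has both ends in \<open>{c, d}\<close>. It lies on both halves
    only if each half is this single edge, which a cycle of length at least 3 excludes.\<close>
  have "pedges (us @ [d]) \<inter> pedges (ws @ [c]) = {}"
  proof (rule ccontr)
    assume "\<not> ?thesis"
    then obtain e where e: "e \<in> pedges (us @ [d])" "e \<in> pedges (ws @ [c])" by auto
    then have eE: "e \<in> E" using sub by auto
    have "e \<subseteq> insert d (set us)" "e \<subseteq> insert c (set ws)" using e u by auto
    then have "e \<subseteq> {c, d}" using assms(3) us ws by auto
    moreover obtain x y where xy: "e = {x, y}" "x \<noteq> y" using edgeE eE by metis
    ultimately have ecd: "e = {c, d}" by auto
    have "us' = []"
    proof (rule ccontr)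
      assume "us' \<noteq> []"
      then have "pedges (us @ [d]) = insert {c, hd us'} (pedges (us' @ [d]))"
        unfolding us by (cases us') auto
      moreover have "e \<notin> pedges (us' @ [d])"
        using Union_pedges_subset [of "us' @ [d]"] ecd assms(3) us ws by auto
      ultimately have "{c, d} = {c, hd us'}" using e ecd by auto
      then show False using \<open>us' \<noteq> []\<close> assms(3) us ws by (auto simp: doubleton_eq_iff)
    qed
    moreover have "ws' = []"
    proof (rule ccontr)
      assume "ws' \<noteq> []"
      then have "pedges (ws @ [c]) = insert {d, hd ws'} (pedges (ws' @ [c]))"
        unfolding ws by (cases ws') auto
      moreover have "e \<notin> pedges (ws' @ [c])"
        using Union_pedges_subset [of "ws' @ [c]"] ecd assms(3) us ws by auto
      ultimately have "{c, d} = {d, hd ws'}" using e ecd by auto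
      then show False using \<open>ws' \<noteq> []\<close> assms(3) us ws by (auto simp: doubleton_eq_iff)
    qed
    ultimately show False using assms(5) us ws by simp
  qed
  then show "img (pedges (us @ [hd ws])) \<inter> img (pedges (ws @ [hd us])) = {p (hd us), p (hd ws)}"
    using img_Int [OF sub] u us ws assms(3) by auto
qed

end

section \<open>Edges on one side of a cycle\<close>

lemma pedges_snoc: "zs \<noteq> [] \<Longrightarrow> pedges (zs @ [b]) = insert {last zs, b} (pedges zs)"
  using pedges_append [of "butlast zs" "last zs" "[b]"]
  by (metis Un_insert_right append.assoc append_Cons append_Nil append_butlast_last_id pedges.simps(1,3) sup_bot_right)

lemma pedges_Cons: "zs \<noteq> [] \<Longrightarrow> pedges (a # zs) = insert {a, hd zs} (pedges zs)"
  by (cases zs) auto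

context plane_graph
begin

text \<open>Only the open arc is tested. Chords, whose ends both lie on the cycle, are therefore
  counted on their side, while the edges of the cycle itself are on neither side.\<close>

definition side_edges :: "complex set \<Rightarrow> 'a set set" where
  "side_edges S = {e \<in> E. open_edge e \<subseteq> S}"

definition side_verts :: "complex set \<Rightarrow> 'a set" where
  "side_verts S = {v \<in> V. p v \<in> S}"

text \<open>Connectivity in the form that minimality yields and \<open>connecting_path\<close>
  consumes: a vertex set that leaves at least three vertices outside is attached to two different
  ones of these. The inner ends \<open>a'\<close> and \<open>b'\<close> may coincide.\<close>

definition biconnected :: bool where
  "biconnected \<longleftrightarrow> (\<forall>D. D \<noteq> {} \<longrightarrow> D \<subseteq> V \<longrightarrow> 3 \<le> card (V - D) \<longrightarrow>
     (\<exists>a b a' b'. a \<in> V - D \<and> b \<in> V - D \<and> a \<noteq> b \<and> a' \<in> D \<and> b' \<in> D \<and> {a, a'} \<in> E \<and> {b, b'} \<in> E))"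

lemma side_edge_notin:
  assumes "F \<subseteq> E" "S \<in> components (- img F)" "e \<in> E" "open_edge e \<subseteq> S"
  shows "e \<notin> F"
proof
  assume "e \<in> F"
  then have "open_edge e \<subseteq> img F" unfolding img_def open_edge_def by auto
  then show False using assms open_edge_props(2) [OF assms(3)] in_components_subset [OF assms(2)] by blast
qed

text \<open>If \<open>e\<close> is a chord, it is itself the path. Otherwise some end
  \<open>y\<close> of \<open>e\<close> is off the cycle. Its component \<open>D\<close> after
  removal of the cycle vertices lies in \<open>S\<close>, and biconnectedness attaches it to two
  different vertices, which can only lie on the cycle.\<close>

lemma connecting_path:
  assumes bi: "biconnected" and vs: "3 \<le> length vs" "distinct vs" "cedges vs \<subseteq> E"
    and S: "S \<in> components (- img (cedges vs))" and e: "e \<in> E" "open_edge e \<subseteq> S"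
  obtains c d zs where "c \<in> set vs" "d \<in> set vs" "c \<noteq> d" "distinct (c # zs @ [d])"
    "set zs \<inter> set vs = {}" "pedges (c # zs @ [d]) \<subseteq> E" "\<And>e. e \<in> pedges (c # zs @ [d]) \<Longrightarrow> open_edge e \<subseteq> S"
proof (cases "e \<subseteq> set vs")
  case True
  obtain u v where uv: "e = {u, v}" "u \<noteq> v" using edgeE e(1) by metis
  show ?thesis using that [of u v "[]"] True uv e by auto
next
  case False
  then obtain y where y: "y \<in> e" "y \<notin> set vs" by auto
  have Un: "\<Union> (cedges vs) = set vs" using vs(1) by (intro Union_cedges) auto
  note iff = open_edge_subset_iff_vertex [OF vs(3) _ _ _ S, unfolded Un]
  define R where "R = {(u, v). {u, v} \<in> E \<and> u \<notin> set vs \<and> v \<notin> set vs}"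
  define D where "D = R\<^sup>* `` {y}"
  have yS: "p y \<in> S" using iff [OF e(1) y] e(2) by simp
  have "z \<in> V \<and> z \<notin> set vs \<and> p z \<in> S" if "(y, z) \<in> R\<^sup>*" for z
    using that
  proof (induction rule: rtrancl_induct)
    case base
    then show ?case using y yS e edge_sub by auto
  next
    case (step w z)
    then have wz: "{w, z} \<in> E" "w \<notin> set vs" "z \<notin> set vs" by (auto simp: R_def)
    then have "p z \<in> S" using iff [OF wz(1), of w] iff [OF wz(1), of z] step by auto
    then show ?case using wz edge_in by auto
  qed
  then have D: "D \<subseteq> V" "D \<inter> set vs = {}" "\<And>z. z \<in> D \<Longrightarrow> p z \<in> S" unfolding D_def by auto
  have "y \<in> D" by (simp add: D_def)
  \<comment> \<open>The cycle alone supplies the three vertices outside \<open>D\<close> that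
    \<open>biconnected\<close> asks for.\<close>
  have "set vs \<subseteq> V - D" using D(2) Un vs(3) edge_sub by fastforce
  moreover have "card (set vs) \<ge> 3" using vs by (simp add: distinct_card)
  ultimately have "3 \<le> card (V - D)" using finite_V by (meson card_mono finite_Diff le_trans)
  then obtain a b a' b' where ab: "a \<in> V - D" "b \<in> V - D" "a \<noteq> b" "a' \<in> D" "b' \<in> D" "{a, a'} \<in> E" "{b, b'} \<in> E"
    using bi D(1) \<open>y \<in> D\<close> unfolding biconnected_def by (metis empty_iff)
  have out: "z \<in> set vs" if "z \<in> V - D" "z' \<in> D" "{z, z'} \<in> E" for z z'
  proof (rule ccontr)
    assume "z \<notin> set vs"
    then have "(z', z) \<in> R" using that D(2) by (auto simp: R_def insert_commute)
    then show False using that unfolding D_def by (meson Diff_iff Image_singleton_iff rtrancl.rtrancl_into_rtrancl)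
  qed
  have "sym R" by (auto simp: R_def sym_def insert_commute)
  then have "(a', b') \<in> R\<^sup>*" using ab(4,5) unfolding D_def
    by (metis Image_singleton_iff rtrancl_trans symD sym_rtrancl)
  then obtain zs where zs: "zs \<noteq> []" "distinct zs" "hd zs = a'" "last zs = b'"
    "set zs \<subseteq> R\<^sup>* `` {a'}" "pedges zs \<subseteq> {{u, v} | u v. (u, v) \<in> R}"
    by (rule rtrancl_distinct_path)
  have zD: "set zs \<subseteq> D" using zs(5) ab(4) unfolding D_def by (auto intro: rtrancl_trans)
  have pe: "pedges (a # zs @ [b]) = insert {a, a'} (insert {b', b} (pedges zs))"
    using pedges_Cons [of "zs @ [b]" a] pedges_snoc [of zs b] zs by simp
  have pE: "pedges zs \<subseteq> E" using zs(6) by (auto simp: R_def)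
  show ?thesis
  proof (rule that [of a b zs])
    show "a \<in> set vs" "b \<in> set vs" using out ab by blast+
    show "a \<noteq> b" by fact
    show "distinct (a # zs @ [b])" using ab zs(2) zD by auto
    show "set zs \<inter> set vs = {}" using zD D(2) by auto
    show sub: "pedges (a # zs @ [b]) \<subseteq> E" using pe pE ab by (auto simp: insert_commute)
    fix f assume f: "f \<in> pedges (a # zs @ [b])"
    \<comment> \<open>Every edge of the path has an end in \<open>D\<close>, hence off the cycle and
      in \<open>S\<close>, and this end pulls the open edge into \<open>S\<close>.\<close>
    have "\<exists>z \<in> D. z \<in> f"
    proof (cases "f \<in> pedges zs")
      case True
      then have "f \<subseteq> set zs" using Union_pedges_subset by fastforce
      moreover have "f \<noteq> {}" using True pE edgeE by blast
      ultimately show ?thesis using zD by blast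
    qed (use f pe ab in auto)
    then obtain z where z: "z \<in> D" "z \<in> f" by auto
    have "z \<notin> set vs" using z D(2) by auto
    then show "open_edge f \<subseteq> S" using iff [of f z] sub f z D(3) by auto
  qed
qed

text \<open>The path from \<open>c\<close> to \<open>d\<close> through \<open>zs\<close> closes up
  each half of the cycle to a new cycle. The two cycles bound the pieces \<open>S1\<close> and
  \<open>S2\<close> of \<open>S\<close> given by the theta curve theorem. Edges and inner vertices
  of the path belong to \<open>S\<close> but to neither piece.\<close>

lemma split_side:
  assumes ne: "us \<noteq> []" "ws \<noteq> []" and dist: "distinct (us @ ws)" and sub: "cedges (us @ ws) \<subseteq> E"
    and len: "3 \<le> length (us @ ws)" and S: "S \<in> components (- img (cedges (us @ ws)))"
    and c: "hd us = c" and d: "hd ws = d"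
    and P: "distinct (c # zs @ [d])" "set zs \<inter> set (us @ ws) = {}" "pedges (c # zs @ [d]) \<subseteq> E"
      "\<And>e. e \<in> pedges (c # zs @ [d]) \<Longrightarrow> open_edge e \<subseteq> S"
  obtains S1 S2 where "S1 \<in> components (- img (cedges (us @ d # rev zs)))"
    "S2 \<in> components (- img (cedges (ws @ c # zs)))"
    "cedges (us @ d # rev zs) \<subseteq> E" "cedges (ws @ c # zs) \<subseteq> E"
    "3 \<le> length (us @ d # rev zs)" "3 \<le> length (ws @ c # zs)"
    "card (side_edges S) \<le> card (side_edges S1) + card (side_edges S2) + Suc (length zs)"
    "card (side_edges S1) < card (side_edges S)" "card (side_edges S2) < card (side_edges S)"
    "card (side_verts S1) + card (side_verts S2) + length zs \<le> card (side_verts S)"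
proof -
  obtain us' where us: "us = c # us'" using ne c by (cases us) auto
  obtain ws' where ws: "ws = d # ws'" using ne d by (cases ws) auto
  define FA FB FP where "FA = pedges (us @ [d])" and "FB = pedges (ws @ [c])" and "FP = pedges (c # zs @ [d])"
  have F: "cedges (us @ ws) = FA \<union> FB" using cedges_append [OF ne] c d by (simp add: FA_def FB_def)
  have F1: "cedges (us @ d # rev zs) = FA \<union> FP"
  proof -
    have "pedges (d # rev zs @ [c]) = FP"
      unfolding FP_def using pedges_rev [of "c # zs @ [d]"] by simp
    then show ?thesis using cedges_append [of us "d # rev zs"] ne c by (simp add: FA_def)
  qed
  have F2: "cedges (ws @ c # zs) = FB \<union> FP"
    using cedges_append [of ws "c # zs"] ne d by (simp add: FB_def FP_def)
  have FE: "FA \<subseteq> E" "FB \<subseteq> E" "FP \<subseteq> E" using sub F P(3) unfolding FP_def by auto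
  have FPd: "FP \<inter> (FA \<union> FB) = {}"
    using side_edge_notin [OF sub S] P(3,4) unfolding F FP_def by blast
  have U: "\<Union> FA = insert d (set us)" "\<Union> FB = insert c (set ws)" "\<Union> FP = {c, d} \<union> set zs"
    using Union_pedges [of "us @ [d]"] Union_pedges [of "ws @ [c]"] Union_pedges [of "c # zs @ [d]"] us ws
    unfolding FA_def FB_def FP_def by auto
  \<comment> \<open>A new cycle of length 2 would mean that the path is a single edge of the old
    cycle, but the path runs within \<open>S\<close>.\<close>
  have len12: "3 \<le> length (us @ d # rev zs)" "3 \<le> length (ws @ c # zs)"
  proof -
    have "us' \<noteq> [] \<or> zs \<noteq> []" 
    proof (rule ccontr)
      assume "\<not> ?thesis"
      then have "FA = FP" using us by (simp add: FA_def FP_def)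
      then show False using FPd unfolding FP_def by (cases zs) auto
    qed
    then show "3 \<le> length (us @ d # rev zs)" using us by (cases us'; cases zs) auto
    have "ws' \<noteq> [] \<or> zs \<noteq> []" 
    proof (rule ccontr)
      assume "\<not> ?thesis"
      then have "FB = FP" using ws by (auto simp: FB_def FP_def insert_commute)
      then show False using FPd unfolding FP_def by (cases zs) auto
    qed
    then show "3 \<le> length (ws @ c # zs)" using ws by (cases ws'; cases zs) auto
  qed
  have cd: "c \<noteq> d" "c \<in> V" "d \<in> V"
    using P(1) U(1) FE(1) edge_sub us by auto
  note C = cycle_img_split [OF ne dist sub len, unfolded c d, folded FA_def FB_def]
  have aP: "arc_between (img FP) (p c) (p d)"
    using path_arc [OF P(1) _ P(3)] unfolding FP_def by simp
  have I1: "img FA \<inter> img FP = {p c, p d}"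
  proof -
    have "img FA \<inter> img FP = p ` (\<Union> FA \<inter> \<Union> FP)" using FE FPd by (intro img_Int) auto
    also have "\<Union> FA \<inter> \<Union> FP = {c, d}" using U P(2) us by auto
    finally show ?thesis by simp
  qed
  have I2: "img FB \<inter> img FP = {p c, p d}"
  proof -
    have "img FB \<inter> img FP = p ` (\<Union> FB \<inter> \<Union> FP)" using FE FPd by (intro img_Int) auto
    also have "\<Union> FB \<inter> \<Union> FP = {c, d}" using U P(2) ws by auto
    finally show ?thesis by simp
  qed
  have T: "theta (p c) (p d) (img FA) (img FB) (img FP)"
    unfolding theta_def using C aP I1 I2 by simp
  have SF: "S \<in> components (- (img FA \<union> img FB))" using S C(1) by simp
  have UF: "\<Union> (cedges (us @ ws)) = set (us @ ws)" using ne by (intro Union_cedges) auto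
  have zsS: "z \<in> V \<and> p z \<in> S" if "z \<in> set zs" for z
  proof -
    have "z \<in> \<Union> FP" using U(3) that by simp
    then obtain f where f: "f \<in> FP" "z \<in> f" by blast
    have fE: "f \<in> E" using f(1) FE(3) by auto
    have "z \<notin> \<Union> (cedges (us @ ws))" using that P(2) UF by blast
    then have "p z \<in> S"
      using open_edge_subset_iff_vertex [OF sub fE f(2) _ S] P(4) f(1) unfolding FP_def by simp
    then show ?thesis using edge_sub [OF fE] f(2) by auto
  qed
  have PS: "img FP - {p c, p d} \<subseteq> S"
  proof
    fix x assume x: "x \<in> img FP - {p c, p d}"
    then obtain f where f: "f \<in> FP" "x \<in> I f" unfolding img_def by auto
    show "x \<in> S"
    proof (cases "x \<in> open_edge f")
      case True
      then show ?thesis using P(4) f unfolding FP_def by blast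
    next
      case False
      then have "x \<in> p ` f" using f by (simp add: open_edge_def)
      then obtain z where z: "x = p z" "z \<in> f" by auto
      then have "z \<in> {c, d} \<union> set zs" using U(3) f by blast
      then show ?thesis using z x zsS by auto
    qed
  qed
  obtain S1 S2 where SS: "S1 \<in> components (- (img FA \<union> img FP))" "S2 \<in> components (- (img FB \<union> img FP))"
    "S1 \<inter> S2 = {}" "S = S1 \<union> S2 \<union> (img FP - {p c, p d})" "S1 \<inter> img FP = {}" "S2 \<inter> img FP = {}"
    by (rule theta_split [OF T SF PS])
  have S1: "S1 \<in> components (- img (FA \<union> FP))" and S2: "S2 \<in> components (- img (FB \<union> FP))"
    using SS(1,2) by (simp_all add: img_Un)
  have fin: "finite (side_edges X)" "finite (side_verts X)" for X
    using finite_E finite_V unfolding side_edges_def side_verts_def by auto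
  have FP_sub: "FP \<subseteq> side_edges S" using FE(3) P(4) unfolding side_edges_def FP_def by auto
  have disj: "side_edges S1 \<inter> side_edges S2 = {}"
    using SS(3) open_edge_props(2) unfolding side_edges_def by blast
  have nP: "side_edges S1 \<inter> FP = {}" "side_edges S2 \<inter> FP = {}"
    using side_edge_notin [OF _ S1] side_edge_notin [OF _ S2] FE unfolding side_edges_def by auto
  have subs: "side_edges S1 \<union> side_edges S2 \<subseteq> side_edges S"
    using SS(4) unfolding side_edges_def by auto
  have "side_edges S \<subseteq> side_edges S1 \<union> side_edges S2 \<union> FP"
  proof
    fix e assume "e \<in> side_edges S"
    then have e: "e \<in> E" "open_edge e \<subseteq> S" by (auto simp: side_edges_def)
    show "e \<in> side_edges S1 \<union> side_edges S2 \<union> FP"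
    proof (cases "e \<in> FP")
      case False
      have nF: "e \<notin> FA \<union> FB" using side_edge_notin [OF sub S e] F by simp
      have "open_edge e \<inter> img FP = {}" using open_edge_disjoint_img [OF FE(3) e(1) False] .
      then have "open_edge e \<subseteq> S1 \<union> S2" using e(2) SS(4) by blast
      then have "open_edge e \<inter> S1 \<noteq> {} \<or> open_edge e \<inter> S2 \<noteq> {}" using open_edge_props(2) [OF e(1)] by blast
      then have "open_edge e \<subseteq> S1 \<or> open_edge e \<subseteq> S2"
        using open_edge_subset_component [OF _ e(1) _ S1] open_edge_subset_component [OF _ e(1) _ S2] FE nF False
        by blast
      then show ?thesis using e by (auto simp: side_edges_def)
    qed simp
  qed
  then have "card (side_edges S) \<le> card (side_edges S1 \<union> side_edges S2 \<union> FP)"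
    using fin finite_pedges unfolding FP_def by (intro card_mono) auto
  also have "\<dots> \<le> card (side_edges S1) + card (side_edges S2) + card FP"
    by (meson add_le_mono1 card_Un_le le_trans)
  also have "card FP \<le> Suc (length zs)" using card_pedges_le [of c "zs @ [d]"] by (simp add: FP_def)
  finally have c1: "card (side_edges S) \<le> card (side_edges S1) + card (side_edges S2) + Suc (length zs)" by simp
  \<comment> \<open>The path has an edge, which both pieces lose; this makes the induction on the
    number of side edges well-founded.\<close>
  have FPne: "FP \<noteq> {}" unfolding FP_def by (cases zs) auto
  have c2: "card (side_edges S1) < card (side_edges S)" "card (side_edges S2) < card (side_edges S)"
    using FPne nP FP_sub subs fin by (auto intro!: psubset_card_mono)
  have "side_verts S1 \<union> side_verts S2 \<union> set zs \<subseteq> side_verts S"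
    using SS(4) zsS unfolding side_verts_def by auto
  then have "card (side_verts S1 \<union> side_verts S2 \<union> set zs) \<le> card (side_verts S)"
    using fin by (intro card_mono) auto
  moreover have "card (side_verts S1 \<union> side_verts S2 \<union> set zs) = card (side_verts S1) + card (side_verts S2) + length zs"
  proof -
    have "side_verts S1 \<inter> side_verts S2 = {}" using SS(3) unfolding side_verts_def by auto
    moreover have "p z \<in> img FP" if "z \<in> set zs" for z
      using vertex_in_img [OF FE(3)] zsS that U(3) by auto
    then have "(side_verts S1 \<union> side_verts S2) \<inter> set zs = {}"
      using SS(5,6) unfolding side_verts_def by blast
    ultimately show ?thesis using fin P(1) by (simp add: card_Un_disjoint distinct_card)
  qed
  ultimately have c3: "card (side_verts S1) + card (side_verts S2) + length zs \<le> card (side_verts S)" by simp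
  show ?thesis
    using that [of S1 S2] S1 S2 F1 F2 FE len12 c1 c2 c3 by simp
qed

text \<open>Let the cutting path have r inner vertices, let k, k1, k2 be the lengths of the cycles
  and m, m1, m2 the numbers of vertices on the sides. Then k1 + k2 = k + 2 r + 2, and the edges
  number at most 3 (m1 + m2) + k1 + k2 - 6 + (r + 1) = 3 (m1 + m2 + r) + k - 3 <= 3 m + k - 3. A
  side without edges satisfies the bound because k >= 3.\<close>

lemma side_bound:
  assumes bi: "biconnected" and "3 \<le> length vs" "distinct vs" "cedges vs \<subseteq> E"
    "S \<in> components (- img (cedges vs))"
  shows "card (side_edges S) + 3 \<le> 3 * card (side_verts S) + length vs"
  using assms(2-)
proof (induction "card (side_edges S)" arbitrary: S vs rule: less_induct)
  case less
  show ?case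
  proof (cases "side_edges S = {}")
    case True
    then show ?thesis using less.prems by simp
  next
    case False
    then obtain e where e: "e \<in> E" "open_edge e \<subseteq> S" by (auto simp: side_edges_def)
    obtain c d zs where P: "c \<in> set vs" "d \<in> set vs" "c \<noteq> d" "distinct (c # zs @ [d])"
      "set zs \<inter> set vs = {}" "pedges (c # zs @ [d]) \<subseteq> E" "\<And>e. e \<in> pedges (c # zs @ [d]) \<Longrightarrow> open_edge e \<subseteq> S"
      by (rule connecting_path [OF bi less.prems e]) blast
    obtain us ws where uw: "us \<noteq> []" "ws \<noteq> []" "hd us = c" "hd ws = d" "distinct (us @ ws)"
      "set (us @ ws) = set vs" "cedges (us @ ws) = cedges vs" "length (us @ ws) = length vs"
      by (rule cycle_split [OF less.prems(2) P(1-3)])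
    have x: "cedges (us @ ws) \<subseteq> E" "3 \<le> length (us @ ws)" "S \<in> components (- img (cedges (us @ ws)))"
      "set zs \<inter> set (us @ ws) = {}"
      using less.prems uw(6-8) P(5) by simp_all
    obtain S1 S2 where s: "S1 \<in> components (- img (cedges (us @ d # rev zs)))"
      "S2 \<in> components (- img (cedges (ws @ c # zs)))"
      "cedges (us @ d # rev zs) \<subseteq> E" "cedges (ws @ c # zs) \<subseteq> E"
      "3 \<le> length (us @ d # rev zs)" "3 \<le> length (ws @ c # zs)"
      "card (side_edges S) \<le> card (side_edges S1) + card (side_edges S2) + Suc (length zs)"
      "card (side_edges S1) < card (side_edges S)" "card (side_edges S2) < card (side_edges S)"
      "card (side_verts S1) + card (side_verts S2) + length zs \<le> card (side_verts S)"
      by (rule split_side [OF uw(1,2,5) x(1-3) uw(3,4) P(4) x(4) P(6,7)]) 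
    have "c \<in> set us" "d \<in> set ws" using uw by auto
    then have dd: "distinct (us @ d # rev zs)" "distinct (ws @ c # zs)"
      using uw(5) x(4) P(4) by auto
    have "card (side_edges S1) + 3 \<le> 3 * card (side_verts S1) + length (us @ d # rev zs)"
      by (rule less.hyps [OF s(8) s(5) dd(1) s(3) s(1)])
    moreover have "card (side_edges S2) + 3 \<le> 3 * card (side_verts S2) + length (ws @ c # zs)"
      by (rule less.hyps [OF s(9) s(6) dd(2) s(4) s(2)])
    ultimately show ?thesis using s(7,10) uw(8) by simp
  qed
qed

end

section \<open>The number of edges of a planar graph\<close>

definition pairs :: "'a set \<Rightarrow> 'a set set" where
  "pairs t = {e. e \<subseteq> t \<and> card e = 2}"

text \<open>Copies of a complete graph, represented by their vertex sets.\<close>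

definition cliques :: "nat \<Rightarrow> 'a set \<Rightarrow> 'a set set \<Rightarrow> 'a set set" where
  "cliques k V E = {t. t \<subseteq> V \<and> card t = k \<and> pairs t \<subseteq> E}"

lemma card_pairs: "finite t \<Longrightarrow> card (pairs t) = card t choose 2"
  unfolding pairs_def by (rule n_subsets)

lemma finite_pairs: "finite t \<Longrightarrow> finite (pairs t)"
  unfolding pairs_def by (rule finite_subset [of _ "Pow t"]) auto

lemma pair_in_pairs: "{u, v} \<in> pairs t \<longleftrightarrow> u \<in> t \<and> v \<in> t \<and> u \<noteq> v"
  unfolding pairs_def by (auto simp: card_insert_if)

lemma finite_cliques: "finite V \<Longrightarrow> finite (cliques k V E)"
  unfolding cliques_def by (rule finite_subset [of _ "Pow V"]) auto

context plane_graph
begin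

lemma subgraph_plane:
  assumes "W \<subseteq> V"
  shows "plane_graph W {e \<in> E. e \<subseteq> W} p I"
proof
  show "finite W" using finite_V assms finite_subset by blast
  show "{e \<in> E. e \<subseteq> W} \<subseteq> {e. e \<subseteq> W \<and> card e = 2}" using E_sub by auto
  show "inj_on p W" using inj_p assms inj_on_subset by blast
  show "arc_between (I {u, v}) (p u) (p v)" if "{u, v} \<in> {e \<in> E. e \<subseteq> W}" for u v
    using that edge_arc by simp
  show "I e \<inter> p ` W = p ` e" if "e \<in> {e \<in> E. e \<subseteq> W}" for e
  proof -
    have "p ` e \<subseteq> p ` W" "p ` W \<subseteq> p ` V" "I e \<inter> p ` V = p ` e"
      using that edge_V [of e] assms by auto
    then show ?thesis by blast
  qed
  show "I e \<inter> I e' \<subseteq> p ` (e \<inter> e')"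
    if "e \<in> {e \<in> E. e \<subseteq> W}" "e' \<in> {e \<in> E. e \<subseteq> W}" "e \<noteq> e'" for e e'
    using that edge_edge by simp
qed

text \<open>All neighbours of the first vertex of a longest path lie on that path. One of them is
  not the second vertex, and the edge to it closes a cycle.\<close>

lemma cycle_exists:
  assumes ne: "V \<noteq> {}" and deg: "\<And>v. v \<in> V \<Longrightarrow> \<exists>a b. a \<noteq> b \<and> {v, a} \<in> E \<and> {v, b} \<in> E"
  obtains vs where "3 \<le> length vs" "distinct vs" "cedges vs \<subseteq> E"
proof -
  define Q where "Q xs \<longleftrightarrow> xs \<noteq> [] \<and> distinct xs \<and> set xs \<subseteq> V \<and> pedges xs \<subseteq> E" for xs
  obtain v0 where "v0 \<in> V" using ne by auto
  then have "Q [v0]" by (simp add: Q_def)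
  moreover have "length xs < Suc (card V)" if "Q xs" for xs
    using that finite_V unfolding Q_def by (metis card_mono distinct_card le_imp_less_Suc)
  ultimately obtain xs where xs: "Q xs" and mx: "\<And>ys. Q ys \<Longrightarrow> length ys \<le> length xs"
    using ex_has_greatest_nat [of Q "[v0]" length "Suc (card V)"] by (metis less_imp_le_nat)
  obtain x ys where xy: "xs = x # ys" using xs by (cases xs) (auto simp: Q_def)
  have nb: "a \<in> set ys" if "{x, a} \<in> E" for a
  proof (rule ccontr)
    assume "a \<notin> set ys"
    then have "Q (a # xs)" using xs that edge_in [OF that] xy unfolding Q_def by (auto simp: insert_commute)
    then show False using mx by fastforce
  qed
  have "x \<in> V" using xs xy by (simp add: Q_def)
  then obtain a b where ab: "a \<noteq> b" "{x, a} \<in> E" "{x, b} \<in> E" using deg by blast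
  then obtain z zs where ys: "ys = z # zs" using nb by (cases ys) fastforce+
  obtain y where y: "{x, y} \<in> E" "y \<in> set zs" using nb [of a] nb [of b] ab ys by auto
  then obtain us ws where zs: "zs = us @ y # ws" by (meson split_list)
  let ?vs = "x # z # us @ [y]"
  have x: "xs = ?vs @ ws" using xy ys zs by simp
  have "pedges ?vs \<subseteq> E" using xs pedges_subset_append(1) [of ?vs ws] unfolding Q_def x by blast
  moreover have "cedges ?vs = insert {y, x} (pedges ?vs)"
    using pedges_snoc [of ?vs x] unfolding cedges_def by simp
  ultimately have "cedges ?vs \<subseteq> E" using y by (simp add: insert_commute)
  moreover have "distinct ?vs" using xs unfolding Q_def x by simp
  ultimately show ?thesis using that [of ?vs] by simp
qed

end

text \<open>If \<open>D\<close> is attached at a single vertex \<open>a\<close>, every edge lies in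
  \<open>V - D\<close> or in \<open>insert a D\<close>. The two bounds add up to 3 (n + 1) - 12 = 3
  n - 9, where n is the number of all vertices, contradicting \<open>many\<close>.\<close>

lemma biconnected_minimal:
  assumes "plane_graph V E p I"
    and IH: "\<And>W. W \<subset> V \<Longrightarrow> 3 \<le> card W \<Longrightarrow> card {e \<in> E. e \<subseteq> W} + 6 \<le> 3 * card W"
    and many: "3 * card V < card E + 6"
  shows "plane_graph.biconnected V E"
proof -
  interpret plane_graph V E p I by fact
  show ?thesis
    unfolding biconnected_def
  proof (intro allI impI, rule ccontr)
    fix D assume D: "D \<noteq> {}" "D \<subseteq> V" "3 \<le> card (V - D)"
    assume neg: "\<not> (\<exists>a b a' b'. a \<in> V - D \<and> b \<in> V - D \<and> a \<noteq> b \<and> a' \<in> D \<and> b' \<in> D \<and> {a, a'} \<in> E \<and> {b, b'} \<in> E)"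
    have fD: "finite D" using D(2) finite_V finite_subset by blast
    have nD: "card V = card D + card (V - D)"
      using D(2) fD finite_V by (simp add: card_Diff_subset card_mono)
    have "V - D \<noteq> {}" using D(3) by (metis card.empty not_numeral_le_zero)
    \<comment> \<open>If no edge leaves \<open>D\<close>, any vertex outside \<open>D\<close> serves
      as \<open>a\<close>.\<close>
    then obtain a where a: "a \<in> V - D" "\<And>b b'. b \<in> V - D \<Longrightarrow> b' \<in> D \<Longrightarrow> {b, b'} \<in> E \<Longrightarrow> b = a"
      using neg by (metis ex_in_conv)
    have cov: "e \<subseteq> V - D \<or> e \<subseteq> insert a D" if e: "e \<in> E" for e
    proof -
      obtain u v where uv: "e = {u, v}" "u \<in> V" "v \<in> V" using edgeE e by metis
      have "{u, v} \<in> E" "{v, u} \<in> E" using e uv by (simp_all add: insert_commute)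
      then show ?thesis using a(2) [of u v] a(2) [of v u] uv by auto
    qed
    have cI: "card (insert a D) = Suc (card D)" using a(1) fD by simp
    have "card E \<le> card ({e \<in> E. e \<subseteq> V - D} \<union> {e \<in> E. e \<subseteq> insert a D})"
      using cov finite_E by (intro card_mono) auto
    also have "\<dots> \<le> card {e \<in> E. e \<subseteq> V - D} + card {e \<in> E. e \<subseteq> insert a D}" by (rule card_Un_le)
    finally have c: "card E \<le> card {e \<in> E. e \<subseteq> V - D} + card {e \<in> E. e \<subseteq> insert a D}" .
    have c1: "card {e \<in> E. e \<subseteq> V - D} + 6 \<le> 3 * card (V - D)" using D by (intro IH) auto
    have "card D \<ge> 1" using D(1) fD by (simp add: Suc_leI card_gt_0_iff)
    then consider "card D = 1" | "card D \<ge> 2" by linarith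
    then show False
    proof cases
      case 1
      \<comment> \<open>The two vertices of \<open>insert a D\<close> are too few for the induction
        hypothesis, but they span at most one edge.\<close>
      have "{e \<in> E. e \<subseteq> insert a D} \<subseteq> {insert a D}"
      proof
        fix e assume e: "e \<in> {e \<in> E. e \<subseteq> insert a D}"
        then have "card e = 2" using E_sub by auto
        then have "e = insert a D" using e cI 1 fD by (intro card_subset_eq) auto
        then show "e \<in> {insert a D}" by simp
      qed
      then have "card {e \<in> E. e \<subseteq> insert a D} \<le> 1" using card_mono [of "{insert a D}"] by fastforce
      then show False using c c1 nD many 1 by linarith
    next
      case 2
      have "insert a D \<noteq> V" using cI nD D(3) by auto
      then have "card {e \<in> E. e \<subseteq> insert a D} + 6 \<le> 3 * card (insert a D)"
        using D a 2 cI by (intro IH) auto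
      then show False using c c1 nD many cI by linarith
    qed
  qed
qed

theorem edge_bound:
  assumes "plane_graph V E p I" "3 \<le> card V"
  shows "card E + 6 \<le> 3 * card V"
  using assms
proof (induction "card V" arbitrary: V E rule: less_induct)
  case less
  interpret plane_graph V E p I by fact
  show ?case
  proof (rule ccontr)
    assume "\<not> ?case"
    then have many: "3 * card V < card E + 6" by simp
    have "plane_graph.biconnected V E"
      using less.prems(1)
    proof (rule biconnected_minimal [OF _ _ many])
      fix W assume W: "W \<subset> V" "3 \<le> card W"
      then show "card {e \<in> E. e \<subseteq> W} + 6 \<le> 3 * card W"
        using less.hyps [OF psubset_card_mono [OF finite_V] subgraph_plane] by auto
    qed
    then have bi: biconnected .
    have E_pairs: "E \<subseteq> pairs V" using E_sub by (auto simp: pairs_def)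
    then have "card E \<le> card V choose 2" using card_mono [OF finite_pairs [OF finite_V]] card_pairs [OF finite_V] by metis
    \<comment> \<open>Three vertices span at most 3 = 3 * 3 - 6 edges. With a fourth vertex,
      \<open>biconnected\<close> applies to singletons and gives every vertex two
      neighbours.\<close>
    then have n4: "4 \<le> card V" using less.prems(2) many by (cases "card V = 3") (auto simp: choose_two)
    have "\<exists>a b. a \<noteq> b \<and> {v, a} \<in> E \<and> {v, b} \<in> E" if v: "v \<in> V" for v
    proof -
      have "3 \<le> card (V - {v})" using n4 v finite_V by simp
      then show ?thesis using bi v unfolding biconnected_def
        by (elim allE [of _ "{v}"]) (auto simp: insert_commute)
    qed
    then obtain vs where vs: "3 \<le> length vs" "distinct vs" "cedges vs \<subseteq> E"
      using cycle_exists n4 by (metis card.empty not_numeral_le_zero)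
    \<comment> \<open>Any two vertices of the cycle present it as a union of two arcs; the first two
      are taken.\<close>
    obtain c d vs' where cd: "vs = c # d # vs'" using vs(1) by (cases vs; cases "tl vs") auto
    obtain us ws where uw: "us \<noteq> []" "ws \<noteq> []" "hd us = c" "hd ws = d" "distinct (us @ ws)"
      "set (us @ ws) = set vs" "cedges (us @ ws) = cedges vs" "length (us @ ws) = length vs"
      using cycle_split [OF vs(2), of c d] cd vs(2) by auto
    define J where "J = img (cedges vs)"
    have x: "cedges (us @ ws) \<subseteq> E" "3 \<le> length (us @ ws)" using uw vs by simp_all
    note C = cycle_img_split [OF uw(1,2,5) x, unfolded uw(7), folded J_def]
    have comp: "components (- J) = {inside J, outside J}"
      using jordan_components [OF C(2-4)] C(1) by simp
    have JJ: "inside J \<union> outside J = - J" "inside J \<inter> outside J = {}"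
      using jordan_arcs(7,8) [OF C(2-4)] C(1) by simp_all
    have b1: "card (side_edges (inside J)) + 3 \<le> 3 * card (side_verts (inside J)) + length vs"
      using side_bound [OF bi vs] comp unfolding J_def by blast
    have b2: "card (side_edges (outside J)) + 3 \<le> 3 * card (side_verts (outside J)) + length vs"
      using side_bound [OF bi vs] comp unfolding J_def by blast
    have "E \<subseteq> cedges vs \<union> side_edges (inside J) \<union> side_edges (outside J)"
    proof
      fix e assume e: "e \<in> E"
      show "e \<in> cedges vs \<union> side_edges (inside J) \<union> side_edges (outside J)"
      proof (cases "e \<in> cedges vs")
        case False
        have "open_edge e \<inter> J = {}" using open_edge_disjoint_img [OF vs(3) e False] J_def by simp
        then have "open_edge e \<inter> inside J \<noteq> {} \<or> open_edge e \<inter> outside J \<noteq> {}"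
          using JJ(1) open_edge_props(2) [OF e] by blast
        then have "open_edge e \<subseteq> inside J \<or> open_edge e \<subseteq> outside J"
          using open_edge_subset_component [OF vs(3) e False] comp unfolding J_def by blast
        then show ?thesis using e by (auto simp: side_edges_def)
      qed simp
    qed
    then have "card E \<le> card (cedges vs \<union> side_edges (inside J) \<union> side_edges (outside J))"
      using finite_E by (intro card_mono) (auto simp: side_edges_def cedges_def finite_pedges)
    also have "\<dots> \<le> card (cedges vs) + card (side_edges (inside J)) + card (side_edges (outside J))"
      by (meson add_le_mono1 card_Un_le le_trans)
    finally have cE: "card E \<le> length vs + card (side_edges (inside J)) + card (side_edges (outside J))"
      using card_cedges_le [of vs] by simp
    have Un: "\<Union> (cedges vs) = set vs" using vs(1) by (intro Union_cedges) auto
    have vV: "set vs \<subseteq> V" using Un vs(3) edge_sub by fastforce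
    have inJ: "p v \<in> J" if "v \<in> set vs" for v
      using vertex_in_img [OF vs(3)] Un vV that unfolding J_def by auto
    have "card (set vs \<union> side_verts (inside J) \<union> side_verts (outside J)) =
       length vs + card (side_verts (inside J)) + card (side_verts (outside J))"
    proof -
      have d1: "side_verts (inside J) \<inter> side_verts (outside J) = {}"
        using JJ(2) unfolding side_verts_def by blast
      have d2: "set vs \<inter> (side_verts (inside J) \<union> side_verts (outside J)) = {}"
        using JJ(1) inJ unfolding side_verts_def by blast
      have f: "finite (side_verts X)" for X using finite_V unfolding side_verts_def by auto
      show ?thesis
        using card_Un_disjoint [OF finite_set _ d2] card_Un_disjoint [OF f f d1] f distinct_card [OF vs(2)]
        by (simp add: Un_assoc)
    qed
    moreover have "card (set vs \<union> side_verts (inside J) \<union> side_verts (outside J)) \<le> card V"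
      using vV finite_V by (intro card_mono) (auto simp: side_verts_def)
    ultimately have "length vs + card (side_verts (inside J)) + card (side_verts (outside J)) \<le> card V"
      by simp
    then show False using many cE b1 b2 by linarith
  qed
qed

section \<open>The number of triangles of a planar graph without K4\<close>

lemma card_3_pairs:
  assumes "x \<noteq> y" "y \<noteq> z" "x \<noteq> z"
  shows "pairs {x, y, z} = {{x, y}, {y, z}, {z, x}}"
proof
  show "pairs {x, y, z} \<subseteq> {{x, y}, {y, z}, {z, x}}"
  proof
    fix e assume "e \<in> pairs {x, y, z}"
    then obtain a b where "e = {a, b}" "a \<noteq> b" "a \<in> {x, y, z}" "b \<in> {x, y, z}"
      unfolding pairs_def by (auto simp: card_2_iff)
    then show "e \<in> {{x, y}, {y, z}, {z, x}}" by (auto simp: insert_commute)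
  qed
  show "{{x, y}, {y, z}, {z, x}} \<subseteq> pairs {x, y, z}" using assms by (auto simp: pair_in_pairs)
qed

lemma cliques_restrict:
  "t \<in> cliques k V E \<Longrightarrow> t \<subseteq> X \<Longrightarrow> t \<in> cliques k X {e \<in> E. e \<subseteq> X}"
  by (auto simp: cliques_def pairs_def)

context plane_graph
begin

text \<open>\<open>S\<close> may be either side. Membership of \<open>p v\<close> in
  \<open>S\<close> already keeps \<open>v\<close> off the triangle, whereas for \<open>w\<close>
  this is demanded separately.\<close>

definition separating_triangle :: bool where
  "separating_triangle \<longleftrightarrow> (\<exists>x y z v w S. {x, y} \<in> E \<and> {y, z} \<in> E \<and> {z, x} \<in> E \<and>
     S \<in> components (- img {{x, y}, {y, z}, {z, x}}) \<and> v \<in> V \<and> p v \<in> S \<and>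
     w \<in> V - {x, y, z} \<and> p w \<notin> S)"

lemma edge_in_two_triangles:
  assumes nsep: "\<not> separating_triangle" and e: "e \<in> E"
  shows "card {t \<in> cliques 3 V E. e \<subseteq> t} \<le> 2"
proof -
  obtain a b where ab: "e = {a, b}" "a \<noteq> b" "a \<in> V" "b \<in> V" using edgeE e by metis
  define W where "W = {w. {a, w} \<in> E \<and> {w, b} \<in> E}"
  have fW: "finite W" using edge_in finite_V unfolding W_def by (auto intro: finite_subset [of _ V])
  have sub: "{t \<in> cliques 3 V E. e \<subseteq> t} \<subseteq> (\<lambda>w. insert w e) ` W"
  proof
    fix t assume t: "t \<in> {t \<in> cliques 3 V E. e \<subseteq> t}"
    then have t3: "card t = 3" "e \<subseteq> t" "pairs t \<subseteq> E" by (auto simp: cliques_def)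
    then have "finite t" by (metis card.infinite zero_neq_numeral)
    then have "card (t - e) = 1" using t3 ab by (simp add: card_Diff_subset)
    then obtain w where w: "t - e = {w}" by (auto simp: card_1_singleton_iff)
    then have tw: "t = insert w e" using t3(2) by blast
    have "{a, w} \<in> pairs t" "{w, b} \<in> pairs t" using w ab(1) tw by (auto simp: pair_in_pairs)
    then show "t \<in> (\<lambda>w. insert w e) ` W" using t3(3) tw unfolding W_def by auto
  qed
  have "card W \<le> 2"
  proof (rule ccontr)
    assume "\<not> card W \<le> 2"
    then have "3 \<le> card W" by simp
    then obtain T where "T \<subseteq> W" "card T = 3" by (meson obtain_subset_with_card_n)
    then obtain x y z where xyz: "x \<in> W" "y \<in> W" "z \<in> W" "x \<noteq> y" "y \<noteq> z" "x \<noteq> z"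
      by (auto simp: card_3_iff)
    \<comment> \<open>\<open>A w\<close> is the drawn path from \<open>a\<close> through
      \<open>w\<close> to \<open>b\<close>, and \<open>E0\<close> the drawn edge itself: arcs with
      common endpoints, any three of which form a theta curve.\<close>
    define A where "A w = img {{a, w}, {w, b}}" for w
    define E0 where "E0 = img {{a, b}}"
    have w: "w \<in> V" "{a, w} \<in> E" "{w, b} \<in> E" "a \<noteq> w" "w \<noteq> b" if "w \<in> W" for w
      using that edge_in unfolding W_def by auto
    have arcs: "arc_between (A w) (p a) (p b)" if "w \<in> W" for w
      using path_arc [of "[a, w, b]"] w [OF that] ab(2) unfolding A_def by simp
    have arc0: "arc_between E0 (p a) (p b)"
      using path_arc [of "[a, b]"] e ab unfolding E0_def by simp
    have i0: "E0 \<inter> A w = {p a, p b}" if "w \<in> W" for w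
    proof -
      have "E0 \<inter> A w = p ` (\<Union> {{a, b}} \<inter> \<Union> {{a, w}, {w, b}})"
        unfolding E0_def A_def
        by (rule img_Int) (use w [OF that] e ab in \<open>auto simp: doubleton_eq_iff\<close>)
      also have "\<Union> {{a, b}} \<inter> \<Union> {{a, w}, {w, b}} = {a, b}" by auto
      finally show ?thesis by simp
    qed
    have i1: "A v \<inter> A w = {p a, p b}" if "v \<in> W" "w \<in> W" "v \<noteq> w" for v w
    proof -
      have "A v \<inter> A w = p ` (\<Union> {{a, v}, {v, b}} \<inter> \<Union> {{a, w}, {w, b}})"
        unfolding A_def
        by (rule img_Int) (use w [OF that(1)] w [OF that(2)] that ab in \<open>auto simp: doubleton_eq_iff\<close>)
      also have "\<Union> {{a, v}, {v, b}} \<inter> \<Union> {{a, w}, {w, b}} = {a, b}" 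
        using that w [OF that(1)] w [OF that(2)] by auto
      finally show ?thesis by simp
    qed
    have th0: "theta (p a) (p b) E0 (A v) (A w)" if "v \<in> W" "w \<in> W" "v \<noteq> w" for v w
      unfolding theta_def using arcs arc0 i0 i1 that by simp
    have th1: "theta (p a) (p b) (A x) (A y) (A z)"
      unfolding theta_def using arcs i1 xyz by simp
    have pA: "p w \<in> A w - {p a, p b}" if "w \<in> W" for w
    proof -
      have "p w \<in> A w" using vertex_in_img [of "{{a, w}, {w, b}}" w] w [OF that] unfolding A_def by auto
      moreover have "p w \<noteq> p a" "p w \<noteq> p b" using inj_p w [OF that] ab by (auto simp: inj_on_def)
      ultimately show ?thesis by simp
    qed
    \<comment> \<open>\<open>E0\<close> and \<open>A u\<close> bound the triangle \<open>a\<close>,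
      \<open>u\<close>, \<open>b\<close>. Its side \<open>far E0 (A u) (A w)\<close> contains
      \<open>v\<close> but not \<open>w\<close>.\<close>
    have key: False if uvw: "u \<in> W" "v \<in> W" "w \<in> W" "u \<noteq> v" "v \<noteq> w" "u \<noteq> w"
      and far: "p v \<in> far E0 (A u) (A w)" for u v w
    proof -
      note fp = far_props [OF th0 [OF uvw(1,3,6)]]
      have "E0 \<union> A u = img {{a, u}, {u, b}, {b, a}}"
        unfolding E0_def A_def img_Un [symmetric] by (simp add: insert_commute)
      then have "far E0 (A u) (A w) \<in> components (- img {{a, u}, {u, b}, {b, a}})"
        using fp(1) by simp
      moreover have "p w \<notin> far E0 (A u) (A w)" using fp(2) pA [OF uvw(3)] by auto
      moreover have "w \<notin> {a, u, b}" using w [OF uvw(3)] uvw by auto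
      moreover have "{a, u} \<in> E" "{u, b} \<in> E" "v \<in> V" "w \<in> V"
        using w [OF uvw(1)] w [OF uvw(2)] w [OF uvw(3)] by simp_all
      moreover have "{b, a} \<in> E" using e ab(1) by (simp add: insert_commute)
      ultimately have separating_triangle
        unfolding separating_triangle_def using far by (intro exI conjI) auto
      then show False using nsep by simp
    qed
    have "p y \<in> far E0 (A x) (A z) \<or> p x \<in> far E0 (A y) (A z) \<or> p x \<in> far E0 (A z) (A y)"
      using four_arcs_separation [OF th0 th0 th0 th1 pA pA pA] xyz by blast
    then show False using key [of x y z] key [of y x z] key [of z x y] xyz by blast
  qed
  have "card {t \<in> cliques 3 V E. e \<subseteq> t} \<le> card ((\<lambda>w. insert w e) ` W)"
    using sub fW by (intro card_mono) auto
  also have "\<dots> \<le> card W" using fW by (rule card_image_le)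
  also have "\<dots> \<le> 2" by fact
  finally show ?thesis .
qed

text \<open>Double counting of the pairs of a triangle and one of its edges.\<close>

lemma triangles_le_edges:
  assumes "\<not> separating_triangle"
  shows "3 * card (cliques 3 V E) \<le> 2 * card E"
proof -
  let ?T = "cliques 3 V E"
  have fT: "finite ?T" using finite_V by (rule finite_cliques)
  have three: "card {e \<in> E. e \<subseteq> t} = 3" if "t \<in> ?T" for t
  proof -
    have t: "card t = 3" "pairs t \<subseteq> E" using that by (auto simp: cliques_def)
    then have "{e \<in> E. e \<subseteq> t} = pairs t" using E_sub by (auto simp: pairs_def)
    moreover have "finite t" using t by (metis card.infinite zero_neq_numeral)
    ultimately show ?thesis using card_pairs [of t] t by (simp add: choose_two)
  qed
  have "3 * card ?T = (\<Sum>t\<in>?T. card {e \<in> E. e \<subseteq> t})" using three by simp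
  also have "\<dots> = (\<Sum>t\<in>?T. \<Sum>e\<in>{e \<in> E. e \<subseteq> t}. 1)" by simp
  also have "\<dots> = (\<Sum>e\<in>E. \<Sum>t\<in>{t \<in> ?T. e \<subseteq> t}. 1)"
    using fT finite_E by (rule sum.swap_restrict)
  also have "\<dots> \<le> (\<Sum>e\<in>E. 2)"
    using edge_in_two_triangles [OF assms] by (intro sum_mono) simp
  finally show ?thesis by simp
qed

text \<open>One part is the triangle with all vertices in \<open>S\<close>, the other consists of
  all vertices not in \<open>S\<close>. The summand 1 accounts for the separating triangle, which
  belongs to both.\<close>

lemma separating_triangle_split:
  assumes "separating_triangle"
  obtains V1 V2 where "V1 \<subset> V" "V2 \<subset> V" "V1 \<union> V2 = V" "card (V1 \<inter> V2) = 3"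
    "card (cliques 3 V E) + 1 \<le>
      card (cliques 3 V1 {e \<in> E. e \<subseteq> V1}) + card (cliques 3 V2 {e \<in> E. e \<subseteq> V2})"
proof -
  obtain x y z v w S where s: "{x, y} \<in> E" "{y, z} \<in> E" "{z, x} \<in> E"
    "S \<in> components (- img {{x, y}, {y, z}, {z, x}})" "v \<in> V" "p v \<in> S"
    "w \<in> V - {x, y, z}" "p w \<notin> S"
    using assms separating_triangle_def by auto
  have xyz: "x \<noteq> y" "y \<noteq> z" "x \<noteq> z" "x \<in> V" "y \<in> V" "z \<in> V" using s(1-3) edge_in by blast+
  define F where "F = {{x, y}, {y, z}, {z, x}}"
  define t where "t = {x, y, z}"
  have F: "F \<subseteq> E" "\<Union> F = t" "S \<in> components (- img F)" using s unfolding F_def t_def by auto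
  have Fp: "F = pairs t" using card_3_pairs xyz unfolding F_def t_def by metis
  have nt: "p u \<notin> S" if "u \<in> t" for u
  proof -
    have "u \<in> V" using that xyz by (auto simp: t_def)
    then have "p u \<in> img F" using vertex_in_img [OF F(1)] F(2) that by blast
    then show ?thesis using in_components_subset [OF F(3)] by blast
  qed
  define V1 V2 where "V1 = t \<union> side_verts S" and "V2 = V - side_verts S"
  have tV: "t \<subseteq> V" using xyz by (auto simp: t_def)
  have "V1 \<subseteq> V" "w \<notin> V1" "w \<in> V" using tV s unfolding V1_def t_def side_verts_def by auto
  then have p1: "V1 \<subset> V" by blast
  have p2: "V2 \<subset> V" using s(5,6) unfolding V2_def side_verts_def by auto
  have un: "V1 \<union> V2 = V" and int: "V1 \<inter> V2 = t"
    using tV nt unfolding V1_def V2_def side_verts_def by auto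
  \<comment> \<open>An edge with an end in \<open>S\<close> runs within \<open>S\<close>, so its
    other end is in \<open>S\<close> or on the triangle.\<close>
  have edge: "e \<subseteq> V1 \<or> e \<subseteq> V2" if e: "e \<in> E" for e
  proof (cases "e \<inter> side_verts S = {}")
    case True
    then show ?thesis using edge_sub [OF e] unfolding V2_def by auto
  next
    case False
    then obtain u where u: "u \<in> e" "p u \<in> S" by (auto simp: side_verts_def)
    then have "u \<notin> \<Union> F" using nt F(2) by auto
    then have "open_edge e \<subseteq> S" using open_edge_subset_iff_vertex [OF F(1) e u(1) _ F(3)] u(2) by simp
    then have "r \<in> V1" if "r \<in> e" for r
      using open_edge_subset_iff_vertex [OF F(1) e that _ F(3)] edge_sub [OF e] that F(2)
      unfolding V1_def side_verts_def by blast
    then show ?thesis by blast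
  qed
  \<comment> \<open>Two vertices of a triangle are adjacent, so they cannot lie strictly on
    different sides.\<close>
  have tri_side: "T \<subseteq> V1 \<or> T \<subseteq> V2" if T: "T \<in> cliques 3 V E" for T
  proof (rule ccontr)
    assume "\<not> ?thesis"
    then obtain r q where rq: "r \<in> T" "r \<notin> V1" "q \<in> T" "q \<notin> V2" by blast
    have TV: "T \<subseteq> V" "pairs T \<subseteq> E" using T by (auto simp: cliques_def)
    have "r \<in> V2" "q \<in> V1" using rq TV un by auto
    then have "r \<noteq> q" using rq by auto
    then have "{r, q} \<in> E" using TV rq by (auto simp: pair_in_pairs subset_iff)
    then show False using edge rq by blast
  qed
  have sub': "T \<in> cliques 3 V1 {e \<in> E. e \<subseteq> V1} \<or> T \<in> cliques 3 V2 {e \<in> E. e \<subseteq> V2}"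
    if "T \<in> cliques 3 V E" for T
    using tri_side [OF that] cliques_restrict [OF that, of V1] cliques_restrict [OF that, of V2] by argo
  have sub: "cliques 3 V E \<subseteq> cliques 3 V1 {e \<in> E. e \<subseteq> V1} \<union> cliques 3 V2 {e \<in> E. e \<subseteq> V2}"
    by (rule subsetI) (simp add: sub')
  let ?A = "cliques 3 V1 {e \<in> E. e \<subseteq> V1}" and ?B = "cliques 3 V2 {e \<in> E. e \<subseteq> V2}"
  have f: "finite ?A" "finite ?B"
    using finite_cliques p1 p2 finite_V by (meson finite_subset psubset_imp_subset)+
  have t3: "card t = 3" using xyz by (simp add: t_def)
  have "t \<subseteq> V1" "t \<subseteq> V2" using int by auto
  moreover have "t \<in> cliques 3 V E" using t3 Fp F(1) tV by (simp add: cliques_def)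
  ultimately have "t \<in> ?A \<inter> ?B" by (intro IntI cliques_restrict)
  then have "0 < card (?A \<inter> ?B)" using f card_gt_0_iff by blast
  then have "1 \<le> card (?A \<inter> ?B)" by simp
  moreover have "card (cliques 3 V E) \<le> card (?A \<union> ?B)" using sub f by (intro card_mono) auto
  moreover have "card ?A + card ?B = card (?A \<union> ?B) + card (?A \<inter> ?B)" using f by (rule card_Un_Int)
  ultimately have "card (cliques 3 V E) + 1 \<le> card ?A + card ?B" by linarith
  then show ?thesis using that [OF p1 p2 un] int t3 by simp
qed

end

text \<open>With at most one of the 10 pairs missing, removal of an end of the missing pair leaves a
  complete graph on four vertices. The planar bound 3 * 5 - 6 = 9 would be too weak here: it gives 3
  t <= 18, but 3 t <= 17 is required.\<close>

lemma K4_free_5: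
  assumes "finite V" "card V = 5" "E \<subseteq> pairs V" "cliques 4 V E = {}"
  shows "card E \<le> 8"
proof (rule ccontr)
  assume "\<not> card E \<le> 8"
  have fP: "finite (pairs V)" "card (pairs V) = 10"
    using assms finite_pairs card_pairs [of V] by (auto simp: choose_two)
  then have "card (pairs V - E) \<le> 1"
    using assms(3) \<open>\<not> card E \<le> 8\<close> by (simp add: card_Diff_subset finite_subset)
  then have one: "e = f" if "e \<in> pairs V - E" "f \<in> pairs V - E" for e f
    using that fP(1) by (metis card_le_Suc0_iff_eq One_nat_def finite_Diff)
  obtain x where x: "x \<in> V" "\<And>e. e \<in> pairs V - E \<Longrightarrow> x \<in> e"
  proof (cases "pairs V - E = {}")
    case True
    have "V \<noteq> {}" using assms(2) by auto
    then show ?thesis using that True by blast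
  next
    case False
    then obtain e where e: "e \<in> pairs V - E" by auto
    then obtain x where "x \<in> e" by (auto simp: pairs_def card_2_iff)
    then show ?thesis using that [of x] one e by (auto simp: pairs_def)
  qed
  have "e \<in> E" if "e \<in> pairs (V - {x})" for e
    using that x(2) [of e] unfolding pairs_def by blast
  then have "V - {x} \<in> cliques 4 V E"
    using x(1) assms(1,2) unfolding cliques_def by auto
  then show False using assms(4) by simp
qed

theorem triangle_bound:
  assumes "plane_graph V E p I" "3 \<le> card V" "cliques 4 V E = {}"
  shows "3 * card (cliques 3 V E) + 18 \<le> 7 * card V"
  using assms
proof (induction "card V" arbitrary: V E rule: less_induct)
  case less
  interpret plane_graph V E p I by fact
  have IH: "3 * card (cliques 3 W {e \<in> E. e \<subseteq> W}) + 18 \<le> 7 * card W" if W: "W \<subset> V" "3 \<le> card W" for W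
  proof -
    have "cliques 4 W {e \<in> E. e \<subseteq> W} \<subseteq> cliques 4 V E" using W(1) by (auto simp: cliques_def)
    then show ?thesis
      using less.hyps [OF psubset_card_mono [OF finite_V W(1)] subgraph_plane W(2)] W(1) less.prems(3) by auto
  qed
  have E_pairs: "E \<subseteq> pairs V" using E_sub by (auto simp: pairs_def)
  show ?case
  proof (cases separating_triangle)
    case True
    obtain V1 V2 where s: "V1 \<subset> V" "V2 \<subset> V" "V1 \<union> V2 = V" "card (V1 \<inter> V2) = 3"
      "card (cliques 3 V E) + 1 \<le>
        card (cliques 3 V1 {e \<in> E. e \<subseteq> V1}) + card (cliques 3 V2 {e \<in> E. e \<subseteq> V2})"
      using True by (rule separating_triangle_split)
    have f: "finite V1" "finite V2" using s(1,2) finite_V by (meson finite_subset psubset_imp_subset)+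
    then have "card V1 + card V2 = card V + 3" using card_Un_Int [OF f] s(3,4) by simp
    moreover have "3 \<le> card V1" "3 \<le> card V2" using s(4) f by (metis card_mono inf_le1, metis card_mono inf_le2)
    ultimately show ?thesis using IH [OF s(1)] IH [OF s(2)] s(5) by linarith
  next
    case False
    note te = triangles_le_edges [OF False]
    \<comment> \<open>From e <= 3 n - 6 follows t <= 2 n - 4, which meets 7/3 n - 6 exactly at n =
      6, the octahedron.\<close>
    consider "card V = 3" | "card V = 4" | "card V = 5" | "6 \<le> card V" using less.prems(2) by linarith
    then show ?thesis
    proof cases
      case 1
      have "cliques 3 V E \<subseteq> {V}" 
      proof
        fix t assume "t \<in> cliques 3 V E"
        then have "t = V" using 1 by (intro card_subset_eq [OF finite_V]) (auto simp: cliques_def)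
        then show "t \<in> {V}" by simp
      qed
      then have "card (cliques 3 V E) \<le> card {V}" by (intro card_mono) simp_all
      then show ?thesis using 1 by simp
    next
      case 2
      have "E \<noteq> pairs V" using less.prems(3) 2 by (auto simp: cliques_def)
      then have "E \<subset> pairs V" using E_pairs by auto
      then have "card E < card (pairs V)" by (rule psubset_card_mono [OF finite_pairs [OF finite_V]])
      also have "card (pairs V) = 6" using card_pairs [OF finite_V] 2 by (simp add: choose_two)
      finally have "card E < 6" .
      then show ?thesis using te 2 by linarith
    next
      case 3
      have "card E \<le> 8" using K4_free_5 [OF finite_V 3 E_pairs less.prems(3)] .
      then show ?thesis using te 3 by linarith
    next
      case 4
      have "card E + 6 \<le> 3 * card V" using edge_bound [OF less.prems(1,2)] .
      then show ?thesis using te 4 by linarith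
    qed
  qed
qed

section \<open>Stacked octahedra\<close>

lemma finite_card_numeral: "card t = numeral k \<Longrightarrow> finite t"
  by (metis card.infinite zero_neq_numeral)

lemma graph_iso_complete:
  "graph_iso (complete_graph k) K \<longleftrightarrow> finite (verts K) \<and> card (verts K) = k \<and> edges K = pairs (verts K)"
proof
  have im: "(\<lambda>e. f ` e) ` pairs S = pairs (f ` S)" if "inj_on f S" for f :: "nat \<Rightarrow> 'a" and S
  proof
    show "(\<lambda>e. f ` e) ` pairs S \<subseteq> pairs (f ` S)"
      using that by (auto simp: pairs_def card_image inj_on_subset)
    show "pairs (f ` S) \<subseteq> (\<lambda>e. f ` e) ` pairs S"
    proof
      fix e assume e: "e \<in> pairs (f ` S)"
      then obtain d where d: "d \<subseteq> S" "e = f ` d" unfolding pairs_def by (auto simp: subset_image_iff)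
      then have "card d = 2" using e that by (auto simp: pairs_def card_image inj_on_subset)
      then show "e \<in> (\<lambda>e. f ` e) ` pairs S" using d by (auto simp: pairs_def)
    qed
  qed
  have c: "verts (complete_graph k) = {..<k}" "edges (complete_graph k) = pairs {..<k}"
    by (auto simp: complete_graph_def pairs_def)
  show "finite (verts K) \<and> card (verts K) = k \<and> edges K = pairs (verts K)"
    if iso: "graph_iso (complete_graph k) K"
  proof -
    obtain f where f: "bij_betw f {..<k} (verts K)" "edges K = (\<lambda>e. f ` e) ` pairs {..<k}"
      using iso unfolding graph_iso_def c by blast
    then have "inj_on f {..<k}" "f ` {..<k} = verts K" by (auto simp: bij_betw_def)
    then show ?thesis
      using im [of f "{..<k}"] f bij_betw_same_card [OF f(1)] bij_betw_finite [OF f(1)] by simp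
  qed
  show "graph_iso (complete_graph k) K"
    if K: "finite (verts K) \<and> card (verts K) = k \<and> edges K = pairs (verts K)"
  proof -
    obtain f where f: "bij_betw f {..<k} (verts K)"
      using K ex_bij_betw_nat_finite [of "verts K"] by (auto simp: atLeast0LessThan)
    then have "inj_on f {..<k}" "f ` {..<k} = verts K" by (auto simp: bij_betw_def)
    then have "edges K = (\<lambda>e. f ` e) ` pairs {..<k}" using im [of f "{..<k}"] K by simp
    then show ?thesis using f unfolding graph_iso_def c by auto
  qed
qed

text \<open>A complete subgraph is determined by its vertex set, which turns the counting of copies
  into the counting of cliques.\<close>

lemma copies_complete:
  assumes "simple_graph G"
  shows "copies (complete_graph k) G = (\<lambda>t. Graph t (pairs t)) ` cliques k (verts G) (edges G)"
proof
  show "copies (complete_graph k) G \<subseteq> (\<lambda>t. Graph t (pairs t)) ` cliques k (verts G) (edges G)"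
  proof
    fix K assume "K \<in> copies (complete_graph k) G"
    then have K: "subgraph K G" "card (verts K) = k" "edges K = pairs (verts K)"
      by (auto simp: copies_def graph_iso_complete)
    then have "verts K \<in> cliques k (verts G) (edges G)" by (auto simp: subgraph_def cliques_def)
    moreover have "K = Graph (verts K) (pairs (verts K))" using K(3) by (metis graph.collapse)
    ultimately show "K \<in> (\<lambda>t. Graph t (pairs t)) ` cliques k (verts G) (edges G)" by blast
  qed
  show "(\<lambda>t. Graph t (pairs t)) ` cliques k (verts G) (edges G) \<subseteq> copies (complete_graph k) G"
    using assms
    by (auto simp: copies_def graph_iso_complete subgraph_def simple_graph_def cliques_def pairs_def
        dest: finite_subset)
qed

lemma card_copies_complete:
  "simple_graph G \<Longrightarrow> card (copies (complete_graph k) G) = card (cliques k (verts G) (edges G))"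
  by (simp add: copies_complete card_image inj_on_def)

lemma cycle_graph_3: "cycle_graph 3 = complete_graph 3"
proof -
  have three: "{..<3} = {0, 1, 2 :: nat}" by auto
  have "{{i, (i + 1) mod 3} |i. i < (3::nat)} = (\<lambda>i. {i, (i + 1) mod 3}) ` {..<3}" by auto
  also have "\<dots> = {{0, 1}, {1, 2}, {2, 0}}" unfolding three by (simp add: numeral_2_eq_2)
  also have "\<dots> = pairs {..<3}" unfolding three by (rule card_3_pairs [symmetric]) auto
  finally show ?thesis unfolding cycle_graph_def complete_graph_def pairs_def by simp
qed

text \<open>\<open>planar\<close> gives the endpoints of an arc as an unordered pair, so the arc may
  have to be reversed.\<close>

lemma planar_plane_graph:
  fixes G :: "'a graph"
  assumes "simple_graph G" "planar G"
  obtains p I where "plane_graph (verts G) (edges G) p I"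
proof -
  obtain p :: "'a \<Rightarrow> complex" and \<gamma> :: "'a set \<Rightarrow> real \<Rightarrow> complex" where pg: "inj_on p (verts G) \<and>
        (\<forall>e\<in>edges G. arc (\<gamma> e) \<and> {pathstart (\<gamma> e), pathfinish (\<gamma> e)} = p ` e \<and>
           path_image (\<gamma> e) \<inter> p ` verts G = p ` e) \<and>
        (\<forall>e\<in>edges G. \<forall>e'\<in>edges G. e \<noteq> e' \<longrightarrow>
           path_image (\<gamma> e) \<inter> path_image (\<gamma> e') \<subseteq> p ` (e \<inter> e'))"
    using assms(2) unfolding planar_def by (elim exE)
  then have p: "inj_on p (verts G)" by simp
  have a: "arc (\<gamma> e)" "{pathstart (\<gamma> e), pathfinish (\<gamma> e)} = p ` e"
      "path_image (\<gamma> e) \<inter> p ` verts G = p ` e" if "e \<in> edges G" for e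
    using pg that by simp_all
  have d: "path_image (\<gamma> e) \<inter> path_image (\<gamma> e') \<subseteq> p ` (e \<inter> e')"
    if "e \<in> edges G" "e' \<in> edges G" "e \<noteq> e'" for e e'
    using pg that by simp
  have "plane_graph (verts G) (edges G) p (\<lambda>e. path_image (\<gamma> e))"
  proof
    show "finite (verts G)" "edges G \<subseteq> {e. e \<subseteq> verts G \<and> card e = 2}"
      using assms(1) by (auto simp: simple_graph_def)
    show "inj_on p (verts G)" by fact
    show "arc_between (path_image (\<gamma> {u, v})) (p u) (p v)" if "{u, v} \<in> edges G" for u v
    proof -
      have "arc_between (path_image (\<gamma> {u, v})) (pathstart (\<gamma> {u, v})) (pathfinish (\<gamma> {u, v}))"
        using a(1) [OF that] arc_between_def by blast
      moreover have "{pathstart (\<gamma> {u, v}), pathfinish (\<gamma> {u, v})} = {p u, p v}" using a(2) [OF that] by simp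
      ultimately show ?thesis by (auto simp: doubleton_eq_iff intro: arc_between_sym)
    qed
  qed (fact a(3), fact d)
  then show ?thesis using that by blast
qed

(* Vertex 3 i + j is the vertex j of the i-th triangle, and (a, b, i, j) encodes the edge from it to
   the vertex j + b (mod 3) of triangle i + a. *)
definition vtx :: "nat \<Rightarrow> nat \<Rightarrow> nat" where
  "vtx i j = 3 * i + j mod 3"

text \<open>The directions (0, 1), (1, 0) and (1, 1) run around a triangle, straight to the next
  triangle, and diagonally to it. The graph is a strip of the triangular lattice rolled up with
  period 3.\<close>

definition steps :: "nat \<Rightarrow> (nat \<times> nat \<times> nat \<times> nat) set" where
  "steps k = {(a, b, i, j). (a, b) \<in> {(0, 1), (1, 0), (1, 1)} \<and> i + a < k \<and> j < 3}"

fun step_edge :: "nat \<times> nat \<times> nat \<times> nat \<Rightarrow> nat set" where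
  "step_edge (a, b, i, j) = {vtx i j, vtx (i + a) (j + b)}"

text \<open>Logarithmic polar coordinates: \<open>s\<close> is the logarithm of the modulus, and
  \<open>t\<close> is the angle in thirds of a full turn, so the period in \<open>t\<close> is
  3.\<close>

definition cyl :: "real \<Rightarrow> real \<Rightarrow> complex" where
  "cyl s t = exp (Complex s (2 * pi * t / 3))"

definition pos :: "nat \<Rightarrow> complex" where
  "pos v = cyl (real (v div 3)) (real (v mod 3))"

text \<open>A straight segment in the coordinates of \<open>cyl\<close>. The angle
  \<open>j + b\<close> is not reduced modulo 3, so edges that pass the angle 0 need no separate
  treatment.\<close>

fun curve :: "nat \<times> nat \<times> nat \<times> nat \<Rightarrow> real \<Rightarrow> complex" where
  "curve (a, b, i, j) \<tau> = cyl (real i + real a * \<tau>) (real j + real b * \<tau>)"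

definition oct_graph :: "nat \<Rightarrow> nat graph" where
  "oct_graph k = Graph {..<3 * k} (step_edge ` steps k)"

lemma cyl_eq_iff: "cyl s t = cyl s' t' \<longleftrightarrow> s = s' \<and> (\<exists>m::int. t = t' + 3 * of_int m)"
proof -
  have "2 * pi * t / 3 = 2 * pi * t' / 3 + 2 * of_int m * pi \<longleftrightarrow> t = t' + 3 * of_int m" for m :: int
  proof -
    have "2 * pi * t / 3 = 2 * pi * t' / 3 + 2 * of_int m * pi \<longleftrightarrow> (2 * pi / 3) * t = (2 * pi / 3) * (t' + 3 * of_int m)"
      by (simp add: algebra_simps)
    also have "\<dots> \<longleftrightarrow> t = t' + 3 * of_int m" by simp
    finally show ?thesis .
  qed
  then show ?thesis unfolding cyl_def exp_eq by (auto simp: complex_eq_iff)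
qed

text \<open>Holds for every \<open>j\<close>, also \<open>j = 3\<close>, which occurs as the end of
  an edge; the number of full turns is \<open>j div 3\<close>.\<close>

lemma curve_0: "curve (a, b, i, j) 0 = pos (vtx i j)"
  by (auto simp: pos_def vtx_def cyl_eq_iff intro!: exI [of _ "int (j div 3)"])
     (metis mult_div_mod_eq add.commute of_nat_add of_nat_mult of_nat_numeral)

lemma curve_1: "curve (a, b, i, j) 1 = pos (vtx (i + a) (j + b))"
  using curve_0 [of 0 0 "i + a" "j + b"] by simp

lemma pos_inj: "pos v = pos w \<Longrightarrow> v = w"
proof -
  assume "pos v = pos w"
  then obtain m :: int where d: "v div 3 = w div 3" and "real (v mod 3) = real (w mod 3) + 3 * of_int m"
    by (auto simp: pos_def cyl_eq_iff)
  then have "int (v mod 3) = int (w mod 3) + 3 * m" by linarith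
  then have "v mod 3 = w mod 3" by presburger
  then show "v = w" using d by (metis div_mult_mod_eq)
qed

text \<open>Vertices have integer coordinates. Since \<open>a\<close> or \<open>b\<close> is 1, a
  parameter at which the curve has integer coordinates is itself an integer.\<close>

lemma curve_not_vertex:
  assumes "q \<in> steps k" "0 < \<tau>" "\<tau> < 1"
  shows "curve q \<tau> \<noteq> pos v"
proof
  assume e: "curve q \<tau> = pos v"
  obtain a b i j where q: "q = (a, b, i, j)" by (metis prod_cases4)
  obtain m :: int where m: "real i + real a * \<tau> = real (v div 3)"
    "real j + real b * \<tau> = real (v mod 3) + 3 * of_int m"
    using e by (auto simp: q pos_def cyl_eq_iff)
  have "a = 1 \<or> b = 1" using assms(1) by (auto simp: steps_def q)
  then have "\<exists>z::int. \<tau> = of_int z"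
  proof
    assume "a = 1"
    then have "\<tau> = of_int (int (v div 3) - int i)" using m(1) by simp
    then show ?thesis by blast
  next
    assume "b = 1"
    then have "\<tau> = of_int (int (v mod 3) + 3 * m - int j)" using m(2) by simp
    then show ?thesis by blast
  qed
  then obtain z :: int where "\<tau> = of_int z" by blast
  then have "0 < z" "z < 1" using assms(2,3) by simp_all
  then show False by simp
qed

(* The fractional parts of the coordinates of an interior point of an edge determine the direction
   (a, b) of the edge and the parameter. *)
lemma curve_inj:
  assumes q: "q \<in> steps k" "q' \<in> steps k" and t: "0 < \<tau>" "\<tau> < 1" "0 \<le> \<tau>'" "\<tau>' \<le> 1"
    and eq: "curve q \<tau> = curve q' \<tau>'"
  shows "q = q' \<and> \<tau> = \<tau>'"
proof -
  obtain a b i j where q1: "q = (a, b, i, j)" by (metis prod_cases4)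
  obtain a' b' i' j' where q2: "q' = (a', b', i', j')" by (metis prod_cases4)
  have t': "0 < \<tau>'" "\<tau>' < 1"
  proof -
    have "curve q \<tau> \<noteq> curve q' 0" "curve q \<tau> \<noteq> curve q' 1"
      unfolding q2 curve_0 curve_1 by (rule curve_not_vertex [OF q(1) t(1,2)])+
    then have "\<tau>' \<noteq> 0" "\<tau>' \<noteq> 1" using eq by auto
    then show "0 < \<tau>'" "\<tau>' < 1" using t by auto
  qed
  obtain m :: int where m: "real i + real a * \<tau> = real i' + real a' * \<tau>'"
    "real j + real b * \<tau> = real j' + real b' * \<tau>' + 3 * of_int m"
    using eq by (auto simp: q1 q2 cyl_eq_iff)
  have j: "j < 3" "j' < 3" using q by (auto simp: q1 q2 steps_def)
  have ab: "(a, b) \<in> {(0, 1), (1, 0), (1, 1)}" "(a', b') \<in> {(0, 1), (1, 0), (1, 1)}"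
    using q by (auto simp: q1 q2 steps_def)
  define z w where "z = int i' - int i" and "w = int j' + 3 * m - int j"
  have zw: "real a * \<tau> - real a' * \<tau>' = of_int z" "real b * \<tau> - real b' * \<tau>' = of_int w"
    using m by (simp_all add: z_def w_def)
  have z01: "x = 0" if "- 1 < real_of_int x" "real_of_int x < 1" for x
  proof -
    have "real_of_int (- 1) < real_of_int x" "real_of_int x < real_of_int 1" using that by simp_all
    then show ?thesis unfolding of_int_less_iff by simp
  qed
  \<comment> \<open>The integers \<open>z\<close> and \<open>w\<close> are differences of numbers in
    [0, 1), hence 0. As the parameters are positive, equal products force equal directions and then
    equal parameters.\<close>
  have zero: "z = 0" "w = 0" using ab zw t t' by (auto intro!: z01)
  then have "a = a' \<and> b = b' \<and> \<tau> = \<tau>'" using ab zw t t' by auto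
  moreover have "i = i'" using zero by (simp add: z_def)
  moreover have "j = j'" using zero j unfolding w_def by presburger
  ultimately show ?thesis by (simp add: q1 q2)
qed

lemma vtx_less: "i < k \<Longrightarrow> vtx i j < 3 * k"
proof -
  assume "i < k"
  moreover have "j mod 3 < 3" by simp
  ultimately show ?thesis unfolding vtx_def by linarith
qed

lemma step_edge_props:
  assumes "q \<in> steps k"
  shows "step_edge q \<subseteq> {..<3 * k}" "card (step_edge q) = 2"
    "{curve q 0, curve q 1} = pos ` step_edge q" "curve q 0 \<noteq> curve q 1"
proof -
  obtain a b i j where q: "q = (a, b, i, j)" by (metis prod_cases4)
  have s: "(a, b) \<in> {(0, 1), (1, 0), (1, 1)}" "i + a < k" "j < 3" using assms by (auto simp: q steps_def)
  have ne: "vtx i j \<noteq> vtx (i + a) (j + b)" using s unfolding vtx_def by auto presburger+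
  have lt: "vtx i j < 3 * k" "vtx (i + a) (j + b) < 3 * k"
    using s(2) by (auto intro!: vtx_less)
  show "step_edge q \<subseteq> {..<3 * k}" "card (step_edge q) = 2" using lt ne by (auto simp: q)
  show "{curve q 0, curve q 1} = pos ` step_edge q" unfolding q curve_0 curve_1 by simp
  show "curve q 0 \<noteq> curve q 1" unfolding q curve_0 curve_1 using ne pos_inj by blast
qed

lemma curve_arc:
  assumes q: "q \<in> steps k"
  shows "arc (curve q)"
proof -
  obtain a b i j where q': "q = (a, b, i, j)" by (metis prod_cases4)
  have "curve q = (\<lambda>\<tau>. cyl (real i + real a * \<tau>) (real j + real b * \<tau>))" by (simp add: q' fun_eq_iff)
  then have "path (curve q)" unfolding path_def cyl_def Complex_eq by (auto intro!: continuous_intros)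
  moreover have "inj_on (curve q) {0..1}"
  proof (rule inj_onI)
    fix x y assume xy: "x \<in> {0..1}" "y \<in> {0..1}" "curve q x = curve q y"
    show "x = y"
    proof (cases "(0 < x \<and> x < 1) \<or> (0 < y \<and> y < 1)")
      case True
      then show ?thesis using curve_inj [OF q q, of x y] curve_inj [OF q q, of y x] xy by auto
    next
      case False
      then have "x = 0 \<or> x = 1" "y = 0 \<or> y = 1" using xy by auto
      then show ?thesis using xy(3) step_edge_props(4) [OF q] by auto
    qed
  qed
  ultimately show ?thesis by (simp add: arc_def)
qed

lemma curve_meets:
  assumes q: "q \<in> steps k" and x: "x \<in> path_image (curve q)"
  obtains v where "x = pos v" "v \<in> step_edge q" | \<tau> where "0 < \<tau>" "\<tau> < 1" "x = curve q \<tau>"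
proof -
  obtain \<tau> where t: "0 \<le> \<tau>" "\<tau> \<le> 1" "x = curve q \<tau>" using x by (auto simp: path_image_def)
  show ?thesis
  proof (cases "0 < \<tau> \<and> \<tau> < 1")
    case False
    then have "\<tau> = 0 \<or> \<tau> = 1" using t by auto
    then have "x \<in> pos ` step_edge q" using step_edge_props(3) [OF q] t(3) by auto
    then show ?thesis using that(1) by blast
  qed (use that(2) t in blast)
qed

section \<open>Planarity and absence of K4\<close>

lemma simple_oct: "simple_graph (oct_graph k)"
  using step_edge_props(1,2) by (fastforce simp: simple_graph_def oct_graph_def)

lemma planar_oct: "planar (oct_graph k)"
proof -
  \<comment> \<open>\<open>planar\<close> asks for one arc for each edge, whereas arcs are given for
    codes; so a code is chosen for every edge.\<close>
  define ix where "ix e = (SOME q. q \<in> steps k \<and> step_edge q = e)" for e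
  have ix: "ix e \<in> steps k" "step_edge (ix e) = e" if "e \<in> step_edge ` steps k" for e
  proof -
    have "\<exists>q. q \<in> steps k \<and> step_edge q = e" using that by blast
    then show "ix e \<in> steps k" "step_edge (ix e) = e" unfolding ix_def by (metis (mono_tags, lifting) someI_ex)+
  qed
  have ends: "pathstart (curve q) = curve q 0" "pathfinish (curve q) = curve q 1" for q
    by (simp_all add: pathstart_def pathfinish_def)
  show ?thesis
    unfolding planar_def oct_graph_def graph.sel
  proof (intro exI [of _ pos] exI [of _ "\<lambda>e. curve (ix e)"] conjI ballI impI)
    show "inj_on pos {..<3 * k}" using pos_inj by (auto intro: inj_onI)
    fix e assume e: "e \<in> step_edge ` steps k"
    show "arc (curve (ix e))" using ix [OF e] by (intro curve_arc)
    show pe: "{pathstart (curve (ix e)), pathfinish (curve (ix e))} = pos ` e"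
      using step_edge_props(3) [OF ix(1) [OF e]] ix(2) [OF e] by (simp add: ends)
    show "path_image (curve (ix e)) \<inter> pos ` {..<3 * k} = pos ` e"
    proof
      show "path_image (curve (ix e)) \<inter> pos ` {..<3 * k} \<subseteq> pos ` e"
      proof
        fix x assume x: "x \<in> path_image (curve (ix e)) \<inter> pos ` {..<3 * k}"
        show "x \<in> pos ` e"
          using ix(1) [OF e] IntD1 [OF x]
        proof (cases rule: curve_meets)
          case (1 v)
          then show ?thesis using ix(2) [OF e] by simp
        next
          case (2 \<tau>)
          then show ?thesis using curve_not_vertex [OF ix(1) [OF e]] x by auto
        qed
      qed
      have "e \<subseteq> {..<3 * k}" using step_edge_props(1) [OF ix(1) [OF e]] ix(2) [OF e] by simp
      moreover have "pos ` e \<subseteq> path_image (curve (ix e))" 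
        unfolding pe [symmetric] by (simp add: pathstart_in_path_image pathfinish_in_path_image)
      ultimately show "pos ` e \<subseteq> path_image (curve (ix e)) \<inter> pos ` {..<3 * k}" by blast
    qed
    fix e' assume e': "e' \<in> step_edge ` steps k" and ne: "e \<noteq> e'"
    have nq: "ix e \<noteq> ix e'" using ix(2) [OF e] ix(2) [OF e'] ne by metis
    show "path_image (curve (ix e)) \<inter> path_image (curve (ix e')) \<subseteq> pos ` (e \<inter> e')"
    proof
      fix x assume x: "x \<in> path_image (curve (ix e)) \<inter> path_image (curve (ix e'))"
      \<comment> \<open>By \<open>curve_inj\<close>, a common point in the interior of either arc
        would make the two codes equal. So it is an end of both edges, and by \<open>pos_inj\<close>
        the same vertex.\<close>
      have vertex: "\<exists>v\<in>f. x = pos v" if f: "f \<in> step_edge ` steps k" "g \<in> step_edge ` steps k"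
        "ix f \<noteq> ix g" "x \<in> path_image (curve (ix f))" "x \<in> path_image (curve (ix g))" for f g
        using ix(1) [OF f(1)] f(4)
      proof (cases rule: curve_meets)
        case (1 v)
        then show ?thesis using ix(2) [OF f(1)] by auto
      next
        case (2 \<tau>)
        obtain \<sigma> where s: "0 \<le> \<sigma>" "\<sigma> \<le> 1" "x = curve (ix g) \<sigma>" using f(5) by (auto simp: path_image_def)
        then show ?thesis
          using curve_inj [OF ix(1) [OF f(1)] ix(1) [OF f(2)] 2(1,2) s(1,2)] 2(3) f(3) by simp
      qed
      obtain v where v: "v \<in> e" "x = pos v" using vertex [OF e e' nq] x by blast
      obtain w where w: "w \<in> e'" "x = pos w" using vertex [OF e' e nq [symmetric]] x by blast
      have "v = w" using v w pos_inj by simp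
      then show "x \<in> pos ` (e \<inter> e')" using v w by blast
    qed
  qed
qed

lemma K4_free_oct: "cliques 4 {..<3 * k} (step_edge ` steps k) = {}"
proof (rule ccontr)
  \<comment> \<open>a proper 3-colouring\<close>
  define c :: "nat \<Rightarrow> nat" where "c v = (v div 3 + v mod 3) mod 3" for v
  assume "\<not> ?thesis"
  then obtain t where t: "card t = 4" "pairs t \<subseteq> step_edge ` steps k" by (auto simp: cliques_def)
  have proper: "c u \<noteq> c v" if uv: "{u, v} \<in> step_edge ` steps k" for u v
  proof -
    obtain a b i j where s: "{u, v} = {vtx i j, vtx (i + a) (j + b)}" "(a, b, i, j) \<in> steps k"
      using uv by auto
    have cv: "c (vtx i j) = (i + j) mod 3" for i j unfolding c_def vtx_def by (simp add: mod_add_right_eq)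
    \<comment> \<open>Every step changes the colour by 1 or 2 modulo 3, and the reduction of the
      index in \<open>vtx\<close> does not affect colours.\<close>
    have "a + b = 1 \<or> a + b = 2" using s(2) by (auto simp: steps_def)
    then have "(i + j) mod 3 \<noteq> ((i + a) + (j + b)) mod 3" by presburger
    then show ?thesis using s(1) cv by (auto simp: doubleton_eq_iff)
  qed
  have "inj_on c t" using t(2) proper by (auto simp: inj_on_def) (metis pair_in_pairs subsetD)
  then have "card (c ` t) = 4" using t(1) by (simp add: card_image)
  moreover have "c ` t \<subseteq> {..<3}" by (auto simp: c_def)
  then have "card (c ` t) \<le> card {..<3::nat}" by (intro card_mono) auto
  ultimately show False by simp
qed

section \<open>Counting the triangles of the stacked octahedra\<close>

lemma oct_edges:
  assumes "i < k"
  shows "{3 * i, 3 * i + 1} \<in> step_edge ` steps k" "{3 * i + 1, 3 * i + 2} \<in> step_edge ` steps k"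
    "{3 * i + 2, 3 * i} \<in> step_edge ` steps k"
proof -
  have "(0, 1, i, j) \<in> steps k" if "j < 3" for j
    using assms that by (simp add: steps_def)
  then have "step_edge (0, 1, i, j) \<in> step_edge ` steps k" if "j < 3" for j
    using that by blast
  from this [of 0] this [of 1] this [of 2]
  show "{3 * i, 3 * i + 1} \<in> step_edge ` steps k" "{3 * i + 1, 3 * i + 2} \<in> step_edge ` steps k"
    "{3 * i + 2, 3 * i} \<in> step_edge ` steps k"
    by (simp_all add: vtx_def)
qed

lemma oct_cross_edges:
  assumes "i + 1 < k"
  shows "{3 * i, 3 * i + 3} \<in> step_edge ` steps k" "{3 * i + 1, 3 * i + 4} \<in> step_edge ` steps k"
    "{3 * i + 2, 3 * i + 5} \<in> step_edge ` steps k" "{3 * i, 3 * i + 4} \<in> step_edge ` steps k"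
    "{3 * i + 1, 3 * i + 5} \<in> step_edge ` steps k" "{3 * i + 2, 3 * i + 3} \<in> step_edge ` steps k"
proof -
  have "(1, b, i, j) \<in> steps k" if "j < 3" "b \<le> 1" for b j
    using assms that by (auto simp: steps_def le_Suc_eq)
  then have "step_edge (1, b, i, j) \<in> step_edge ` steps k" if "j < 3" "b \<le> 1" for b j
    using that by blast
  from this [of 0 0] this [of 1 0] this [of 2 0] this [of 0 1] this [of 1 1] this [of 2 1]
  show "{3 * i, 3 * i + 3} \<in> step_edge ` steps k" "{3 * i + 1, 3 * i + 4} \<in> step_edge ` steps k"
    "{3 * i + 2, 3 * i + 5} \<in> step_edge ` steps k" "{3 * i, 3 * i + 4} \<in> step_edge ` steps k"
    "{3 * i + 1, 3 * i + 5} \<in> step_edge ` steps k" "{3 * i + 2, 3 * i + 3} \<in> step_edge ` steps k"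
    by (simp_all add: vtx_def algebra_simps)
qed

lemma triangle_clique:
  assumes "{x, y} \<in> E" "{y, z} \<in> E" "{z, x} \<in> E" "x \<noteq> y" "y \<noteq> z" "x \<noteq> z" "{x, y, z} \<subseteq> V"
  shows "{x, y, z} \<in> cliques 3 V E"
  using assms card_3_pairs [of x y z] by (simp add: cliques_def)

lemma steps_mono: "k \<le> l \<Longrightarrow> steps k \<subseteq> steps l"
  by (auto simp: steps_def)

(* The triangles of the octahedron on 0, ..., 5, except its base {0, 1, 2}. *)
definition oct_triangles :: "nat set set" where
  "oct_triangles = {{3, 4, 5}, {0, 3, 4}, {1, 4, 5}, {2, 5, 3}, {0, 1, 4}, {1, 2, 5}, {2, 0, 3}}"

lemma card_oct_triangles: "7 \<le> card oct_triangles"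
proof -
  \<comment> \<open>the seven sets are told apart by reading them as binary numerals\<close>
  have "(\<lambda>t. \<Sum>x\<in>t. 2 ^ x :: nat) ` oct_triangles = {56, 25, 50, 44, 19, 38, 13}"
    unfolding oct_triangles_def image_insert image_empty by simp
  then have "card ((\<lambda>t. \<Sum>x\<in>t. 2 ^ x :: nat) ` oct_triangles) = 7" by simp
  moreover have "finite oct_triangles" by (simp add: oct_triangles_def)
  ultimately show ?thesis using card_image_le by metis
qed

text \<open>For n = 3 (l + 1) the number 7 l + 1 is exactly 7/3 n - 6. Each further layer
  contributes the seven triangles of \<open>oct_triangles\<close>.\<close>

lemma triangles_oct: "7 * l + 1 \<le> card (cliques 3 {..<3 * Suc l} (step_edge ` steps (Suc l)))"
proof (induction l)
  case 0
  have "{0, 1, 2} \<in> cliques 3 {..<3} (step_edge ` steps 1)"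
    using oct_edges [of 0 1] by (intro triangle_clique) (simp_all add: numeral_2_eq_2)
  then have "card (cliques 3 {..<3} (step_edge ` steps 1)) > 0"
    using finite_cliques [of "{..<3::nat}"] card_gt_0_iff by blast
  then show ?case by simp
next
  case (Suc l)
  define F where "F = step_edge ` steps (Suc (Suc l))"
  define C where "C = cliques 3 {..<3 * Suc l} (step_edge ` steps (Suc l))"
  define D where "D = cliques 3 {..<3 * Suc (Suc l)} F"
  \<comment> \<open>The shift by \<open>m\<close> moves the octahedron on 0, ..., 5 onto the last
    two layers.\<close>
  define m where "m = 3 * l"
  define N where "N = (\<lambda>t. (+) m ` t) ` oct_triangles"
  define adj where "adj x y \<longleftrightarrow> {m + x, m + y} \<in> F" for x y
  have adj_sym: "adj x y \<Longrightarrow> adj y x" for x y by (simp add: adj_def insert_commute)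
  have e1: "adj 0 1" "adj 1 2" "adj 2 0"
    using oct_edges [of l "Suc (Suc l)"] by (simp_all add: adj_def F_def m_def)
  have e2: "adj 3 4" "adj 4 5" "adj 5 3"
    using oct_edges [of "Suc l" "Suc (Suc l)"] by (simp_all add: adj_def F_def m_def add.commute)
  have e3: "adj 0 3" "adj 1 4" "adj 2 5" "adj 0 4" "adj 1 5" "adj 2 3"
    using oct_cross_edges [of l "Suc (Suc l)"] by (simp_all add: adj_def F_def m_def)
  note e = e1 e2 e3
  have t: "(+) m ` {x, y, z} \<in> D"
    if "adj x y" "adj y z" "adj z x" "x \<noteq> y" "y \<noteq> z" "x \<noteq> z" "x < 6" "y < 6" "z < 6" for x y z
    unfolding D_def image_insert image_empty using that unfolding adj_def
    by (intro triangle_clique) (simp_all add: m_def)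
  have "\<forall>t\<in>oct_triangles. (+) m ` t \<in> D"
    unfolding oct_triangles_def ball_simps
    by (intro conjI TrueI; rule t; (rule e | rule e [THEN adj_sym] | simp))
  then have "N \<subseteq> D" unfolding N_def by blast
  moreover have "C \<subseteq> D"
    using image_mono [OF steps_mono [of "Suc l" "Suc (Suc l)"], of step_edge]
    unfolding C_def D_def F_def cliques_def by auto
  moreover have "C \<inter> N = {}"
  proof -
    \<comment> \<open>After the shift, a vertex that is at least 3 belongs to the new layer, so none
      of the seven triangles was there before.\<close>
    have "\<forall>t\<in>oct_triangles. \<exists>x\<in>t. 3 \<le> x" by (simp add: oct_triangles_def)
    then have "\<not> t \<subseteq> {..<3 * Suc l}" if "t \<in> N" for t
      using that unfolding N_def m_def by fastforce
    then show ?thesis unfolding C_def cliques_def by blast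
  qed
  moreover have N7: "7 \<le> card N"
  proof -
    have "inj_on (\<lambda>t. (+) m ` t) oct_triangles" by (intro inj_onI) (simp add: inj_image_eq_iff)
    then show ?thesis unfolding N_def using card_oct_triangles by (simp add: card_image)
  qed
  moreover have fD: "finite D" unfolding D_def by (intro finite_cliques) simp
  ultimately have "card (C \<union> N) = card C + card N" "card (C \<union> N) \<le> card D"
    using finite_subset [OF _ fD] by (blast intro: card_Un_disjoint, simp add: card_mono)
  then have "card C + 7 \<le> card D" using N7 by linarith
  then show ?case using Suc unfolding C_def D_def F_def by simp
qed

text \<open>Everything needed to evaluate \<open>Max\<close>, with the bounds multiplied by 3 to
  stay within the natural numbers. Finiteness itself follows from the upper bound.\<close>

lemma ex_planar_triangles:
  fixes n :: nat
  assumes n: "3 \<le> n"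
  defines "X \<equiv> {card (copies (cycle_graph 3) G) | G :: nat graph.
      simple_graph G \<and> card (verts G) = n \<and> planar G \<and> copies (complete_graph 4) G = {}}"
  shows "finite X" "X \<noteq> {}" "\<And>x. x \<in> X \<Longrightarrow> 3 * x + 18 \<le> 7 * n"
    "3 dvd n \<Longrightarrow> \<exists>x\<in>X. 7 * n \<le> 3 * x + 18"
proof -
  show bd: "3 * x + 18 \<le> 7 * n" if x: "x \<in> X" for x
  proof -
    obtain G :: "nat graph" where G: "x = card (copies (cycle_graph 3) G)" "simple_graph G"
      "card (verts G) = n" "planar G" "copies (complete_graph 4) G = {}"
      using x unfolding X_def by blast
    obtain p I where pl: "plane_graph (verts G) (edges G) p I" using G(2,4) by (rule planar_plane_graph)
    have "cliques 4 (verts G) (edges G) = {}" using copies_complete [OF G(2), of 4] G(5) by simp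
    then show ?thesis
      using triangle_bound [OF pl] G(1,3) n by (simp add: cycle_graph_3 card_copies_complete [OF G(2)])
  qed
  then have "X \<subseteq> {..7 * n}" by fastforce
  then show "finite X" using finite_subset by blast
  have memb: "card (cliques 3 (verts G) (edges G)) \<in> X"
    if "simple_graph G" "card (verts G) = n" "planar G" "cliques 4 (verts G) (edges G) = {}" for G :: "nat graph"
  proof -
    have "copies (complete_graph 4) G = {}" using copies_complete [OF that(1), of 4] that(4) by simp
    then show ?thesis
      using that(1-3) unfolding X_def card_copies_complete [OF that(1), symmetric] cycle_graph_3 by blast
  qed
  \<comment> \<open>The edgeless graph, drawn at the points 0, ..., n - 1, shows that the set is not
    empty.\<close>
  have "cliques 4 {..<n} {} = {}"
    using card_pairs [OF finite_card_numeral] by (fastforce simp: cliques_def choose_two)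
  moreover have "planar (Graph {..<n} {})"
    unfolding planar_def by (intro exI [of _ "of_nat :: nat \<Rightarrow> complex"]) (simp add: inj_on_def)
  ultimately have "card (cliques 3 {..<n} {}) \<in> X"
    using memb [of "Graph {..<n} {}"] by (simp add: simple_graph_def)
  then show "X \<noteq> {}" by blast
  show "\<exists>x\<in>X. 7 * n \<le> 3 * x + 18" if dvd: "3 dvd n"
  proof -
    obtain k where k: "n = 3 * k" using dvd by (elim dvdE)
    then obtain l where l: "k = Suc l" using n by (cases k) auto
    have "card (cliques 3 (verts (oct_graph k)) (edges (oct_graph k))) \<in> X"
      by (intro memb simple_oct planar_oct) (simp_all add: oct_graph_def k K4_free_oct)
    moreover have "7 * n \<le> 3 * card (cliques 3 (verts (oct_graph k)) (edges (oct_graph k))) + 18"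
      using triangles_oct [of l] by (simp add: oct_graph_def k l)
    ultimately show ?thesis by blast
  qed
qed

theorem theorem5:
  fixes n :: nat
  assumes "n \<ge> 3"
  shows "real (ex_planar n (cycle_graph 3) (complete_graph 4)) \<le> 7 / 3 * real n - 6 \<and>
         (3 dvd n \<longrightarrow>
            real (ex_planar n (cycle_graph 3) (complete_graph 4)) = 7 / 3 * real n - 6)"
proof -
  let ?m = "ex_planar n (cycle_graph 3) (complete_graph 4)"
  define X where "X = {card (copies (cycle_graph 3) G) | G :: nat graph.
      simple_graph G \<and> card (verts G) = n \<and> planar G \<and> copies (complete_graph 4) G = {}}"
  note X = ex_planar_triangles [OF assms, folded X_def]
  have "3 * ?m + 18 \<le> 7 * n"
    unfolding ex_planar_def X_def [symmetric] by (rule X(3) [OF Max_in [OF X(1,2)]])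
  then have upper: "real ?m \<le> 7 / 3 * real n - 6" by linarith
  have lower: "7 / 3 * real n - 6 \<le> real ?m" if dvd: "3 dvd n"
  proof -
    obtain x where x: "x \<in> X" "7 * n \<le> 3 * x + 18" using X(4) [OF dvd] by blast
    have "x \<le> ?m" unfolding ex_planar_def X_def [symmetric] by (rule Max_ge [OF X(1) x(1)])
    then show ?thesis using x(2) by linarith
  qed
  show ?thesis using upper by (intro conjI impI antisym lower)
qed

end
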